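(* The following are equivalent: (i) for each $\epsilon>0$ there exists $r_1$ such that if $T_h$ ($h\in L^\infty(\mathbb T)$) is a self-adjoint Toeplitz operator with $\hat h(0)=0$, then there is an $r_1$-paving $\{A_1,\dots,A_{r_1}\}$ of $\mathbb N$ such that $\|P_{A_i}T_hP_{A_i}\|\le\epsilon\|T_h\|$ for $i=1,\dots,r_1$; (ii) for each $\epsilon>0$ there exists $r_2$ such that if $T_f$ is a Toeplitz operator with $f\in H^\infty_0(\mathbb T)$, then there is an $r_2$-paving $\{A_1,\dots,A_{r_2}\}$ of $\mathbb N$ such that $\|P_{A_i}T_fP_{A_i}\|\le\epsilon\|T_f\|$ for $i=1,\dots,r_2$.
   Context: $\mathbb T$ is the unit circle in the complex plane. For $f\in L^\infty(\mathbb T)$ and $n\in\mathbb Z$, $\hat f(n)=\frac1{2\pi}\int_0^{2\pi}f(e^{it})e^{-int}\,dt$ is the $n$-th Fourier coefficient, and the Toeplitz operator with symbol $f$ is the operator $T_f\in B(\ell^2(\mathbb N))$ whose matrix with respect to the canonical orthonormal basis is $T_f=(\hat f(i-j))_{i,j\in\mathbb N}$. $H^\infty_0(\mathbb T)$ is the set of $f\in L^\infty(\mathbb T)$ with $\hat f(n)=0$ for all $n\le0$. For $A\subseteq\mathbb N$, $P_A$ is the diagonal projection whose $(i,i)$ entry is $1$ if and only if $i\in A$. An $r$-paving of $\mathbb N$ is a finite collection of disjoint subsets $\{A_1,\dots,A_r\}$ with $\mathbb N=A_1\cup\dots\cup A_r$. *)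

theory Defs
  imports "HOL-Analysis.Analysis"
begin

section \<open>The Hilbert space of square-summable complex sequences\<close>

typedef ell2 = "{x :: nat \<Rightarrow> complex. summable (\<lambda>i. (cmod (x i))\<^sup>2)}"
  morphisms coord Abs_ell2
  by (rule exI[of _ "\<lambda>_. 0"]) simp

setup_lifting type_definition_ell2

lemma summable_coord: "summable (\<lambda>i. (cmod (coord x i))\<^sup>2)"
  using coord by blast

lemma summable_prod_sq:
  fixes x y :: "nat \<Rightarrow> complex"
  assumes "summable (\<lambda>i. (cmod (x i))\<^sup>2)" "summable (\<lambda>i. (cmod (y i))\<^sup>2)"
  shows "summable (\<lambda>i. x i * cnj (y i))"
proof (rule summable_comparison_test')
  show "summable (\<lambda>i. (cmod (x i))\<^sup>2 + (cmod (y i))\<^sup>2)"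
    using assms by (rule summable_add)
  show "norm (x i * cnj (y i)) \<le> (cmod (x i))\<^sup>2 + (cmod (y i))\<^sup>2" for i
    using sum_squares_bound[of "cmod (x i)" "cmod (y i)"]
      mult_nonneg_nonneg[OF norm_ge_zero norm_ge_zero, of "x i" "y i"]
    by (simp only: norm_mult complex_mod_cnj mult.assoc)
qed

lemma summable_add_sq:
  fixes x y :: "nat \<Rightarrow> complex"
  assumes "summable (\<lambda>i. (cmod (x i))\<^sup>2)" "summable (\<lambda>i. (cmod (y i))\<^sup>2)"
  shows "summable (\<lambda>i. (cmod (x i + y i))\<^sup>2)"
proof (rule summable_comparison_test')
  show "summable (\<lambda>i. 2 * (cmod (x i))\<^sup>2 + 2 * (cmod (y i))\<^sup>2)"
    using assms by (intro summable_add summable_mult)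
  show "norm ((cmod (x i + y i))\<^sup>2) \<le> 2 * (cmod (x i))\<^sup>2 + 2 * (cmod (y i))\<^sup>2" for i
  proof -
    have "(cmod (x i + y i))\<^sup>2 \<le> (cmod (x i) + cmod (y i))\<^sup>2"
      by (intro power_mono norm_triangle_ineq) auto
    also have "\<dots> \<le> 2 * (cmod (x i))\<^sup>2 + 2 * (cmod (y i))\<^sup>2"
      using sum_squares_bound[of "cmod (x i)" "cmod (y i)"] by (simp add: power2_sum)
    finally show ?thesis by simp
  qed
qed

definition cinner :: "ell2 \<Rightarrow> ell2 \<Rightarrow> complex" where
  "cinner x y = (\<Sum>i. coord x i * cnj (coord y i))"

lemma summable_cinner: "summable (\<lambda>i. coord x i * cnj (coord y i))"
  by (intro summable_prod_sq summable_coord)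

instantiation ell2 :: real_vector
begin

lift_definition zero_ell2 :: ell2 is "\<lambda>_. 0" by simp
lift_definition plus_ell2 :: "ell2 \<Rightarrow> ell2 \<Rightarrow> ell2" is "\<lambda>x y i. x i + y i"
  by (rule summable_add_sq)
lift_definition uminus_ell2 :: "ell2 \<Rightarrow> ell2" is "\<lambda>x i. - x i" by simp
lift_definition minus_ell2 :: "ell2 \<Rightarrow> ell2 \<Rightarrow> ell2" is "\<lambda>x y i. x i - y i"
  using summable_add_sq[of _ "\<lambda>i. - _ i"] by simp
lift_definition scaleR_ell2 :: "real \<Rightarrow> ell2 \<Rightarrow> ell2" is "\<lambda>r x i. complex_of_real r * x i"
  by (simp add: norm_mult power_mult_distrib summable_mult)

instance
  by standard (transfer, simp add: algebra_simps fun_eq_iff)+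

end

text \<open>The real inner product is the real part of the complex one, so both give the norm
  \<open>sqrt (\<Sum>i. (cmod (coord x i))\<^sup>2)\<close>.\<close>

instantiation ell2 :: real_inner
begin

definition inner_ell2 :: "ell2 \<Rightarrow> ell2 \<Rightarrow> real" where "inner_ell2 x y = Re (cinner x y)"
definition norm_ell2 :: "ell2 \<Rightarrow> real" where "norm_ell2 x = sqrt (\<Sum>i. (cmod (coord x i))\<^sup>2)"
definition sgn_ell2 :: "ell2 \<Rightarrow> ell2" where "sgn_ell2 x = x /\<^sub>R norm x"
definition dist_ell2 :: "ell2 \<Rightarrow> ell2 \<Rightarrow> real" where "dist_ell2 x y = norm (x - y)"
definition uniformity_ell2 :: "(ell2 \<times> ell2) filter" where
  "uniformity_ell2 = (INF e\<in>{0<..}. principal {(x, y). dist x y < e})"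
definition open_ell2 :: "ell2 set \<Rightarrow> bool" where
  "open_ell2 U = (\<forall>x\<in>U. eventually (\<lambda>(x', y). x' = x \<longrightarrow> y \<in> U) uniformity)"

lemma inner_self_ell2: "inner x x = (\<Sum>i. (cmod (coord x i))\<^sup>2)" for x :: ell2
  by (simp add: inner_ell2_def cinner_def summable_coord
      flip: complex_norm_square suminf_of_real of_real_power del: of_real_power)

instance
proof
  fix x y z :: ell2 and a :: real
  show "sgn x = x /\<^sub>R norm x" "dist x y = norm (x - y)"
       "uniformity = (INF e\<in>{0<..}. principal {(x, y). dist (x :: ell2) y < e})"
       "open U = (\<forall>x\<in>U. eventually (\<lambda>(x', y). x' = x \<longrightarrow> y \<in> U) uniformity)" for U :: "ell2 set"
    by (fact sgn_ell2_def dist_ell2_def uniformity_ell2_def open_ell2_def)+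
  show "inner x y = inner y x"
    by (simp add: inner_ell2_def cinner_def Re_suminf summable_cinner mult.commute)
  show "inner (x + y) z = inner x z + inner y z"
    by (simp add: inner_ell2_def cinner_def plus_ell2.rep_eq distrib_right summable_cinner
        flip: suminf_add)
  show "inner (a *\<^sub>R x) y = a * inner x y"
    by (simp add: inner_ell2_def cinner_def scaleR_ell2.rep_eq mult.assoc summable_cinner
        suminf_mult)
  show "0 \<le> inner x x"
    by (simp add: inner_self_ell2 suminf_nonneg summable_coord)
  show "inner x x = 0 \<longleftrightarrow> x = 0"
    by (simp add: inner_self_ell2 suminf_eq_zero_iff summable_coord)
       (transfer, simp add: fun_eq_iff)
  show "norm x = sqrt (inner x x)"
    by (simp add: norm_ell2_def inner_self_ell2)
qed

end

definition self_adjoint :: "(ell2 \<Rightarrow> ell2) \<Rightarrow> bool" where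
  "self_adjoint T \<longleftrightarrow> (\<forall>x y. cinner (T x) y = cinner x (T y))"

lift_definition diag_proj :: "nat set \<Rightarrow> ell2 \<Rightarrow> ell2" is "\<lambda>A x i. if i \<in> A then x i else 0"
  by (rule summable_comparison_test') (auto split: if_splits)


section \<open>Symbols on the unit circle and Toeplitz operators\<close>

text \<open>Elements of \<open>L\<^sup>\<infinity>\<close> are represented by functions, not by classes modulo null sets; only the
  values on the unit circle matter.\<close>

definition Linf_circle :: "(complex \<Rightarrow> complex) set" where
  "Linf_circle = {f. (\<lambda>t. f (cis t)) \<in> borel_measurable (lebesgue_on {0..2*pi}) \<and>
     (\<exists>C. AE t in lebesgue_on {0..2*pi}. cmod (f (cis t)) \<le> C)}"

definition fourier_coeff :: "(complex \<Rightarrow> complex) \<Rightarrow> int \<Rightarrow> complex" where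
  "fourier_coeff f n =
     1 / (2*pi) * (LINT t|lebesgue_on {0..2*pi}. f (cis t) * cis (- (of_int n * t)))"

definition Hinf0_circle :: "(complex \<Rightarrow> complex) set" where
  "Hinf0_circle = {f \<in> Linf_circle. \<forall>n\<le>0. fourier_coeff f n = 0}"

text \<open>The operator given by the matrix \<open>(fourier_coeff f (i - j))\<close> with respect to the canonical
  orthonormal basis. For \<open>f \<in> Linf_circle\<close> each series converges (absolutely) and the resulting
  sequence is square-summable, so the abstraction function is applied inside its proper domain;
  the operator is then bounded, so \<open>onorm\<close> is its operator norm.\<close>

definition toeplitz :: "(complex \<Rightarrow> complex) \<Rightarrow> ell2 \<Rightarrow> ell2" where
  "toeplitz f x = Abs_ell2 (\<lambda>i. \<Sum>j. fourier_coeff f (int i - int j) * coord x j)"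


section \<open>Pavings\<close>

text \<open>Blocks are indexed by \<open>{1..r}\<close> and may be empty.\<close>

definition paving :: "nat \<Rightarrow> (nat \<Rightarrow> nat set) \<Rightarrow> bool" where
  "paving r A \<longleftrightarrow> disjoint_family_on A {1..r} \<and> (\<Union>i\<in>{1..r}. A i) = UNIV"

end

theory Submission
  imports Defs
begin

text \<open>From (i) to (ii): pave the real and imaginary parts of the symbol and take the common
  refinement; both parts give operators of norm at most \<open>\<parallel>T\<^sub>f\<parallel>\<close>, by comparison of quadratic forms.

  From (ii) to (i): let \<open>|u| \<le> 1\<close> be the normalized symbol, of mean zero. The positive function
  \<open>1 + \<delta>u\<close> factors as \<open>|g|\<^sup>2\<close> with \<open>g\<close> analytic, and Szego's extremal problem for the weight
  \<open>1/(1 + \<delta>u)\<close> gives \<open>a\<^sup>2 \<ge> 1 - 2\<delta>\<^sup>2\<close> for \<open>a = g(0)\<close>: the loss is quadratic in \<open>\<delta>\<close>. On a block where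
  \<open>T\<^sub>f\<close>, \<open>f = g - a\<close>, is compressed to norm \<open>O(\<delta>\<^sup>2)\<close>, the operator \<open>T\<^sub>g\<close> is bounded below by
  \<open>a - O(\<delta>\<^sup>2)\<close>, so \<open>I + \<delta>T\<^sub>u = T\<^sub>g\<^sup>* T\<^sub>g\<close> is bounded below by \<open>1 - O(\<delta>\<^sup>2)\<close> there, i.e.
  \<open>T\<^sub>u \<ge> -O(\<delta>)\<close>. The same applied to \<open>-u\<close> gives the upper bound.\<close>

section \<open>Square-summable sequences\<close>

text \<open>Szego's problem is posed for the inverse weight so that its solution is already the
  factor: if \<open>|\<phi>|^2 / w\<close> is the constant \<open>D\<close>, then
  \<open>|\<phi>|^2 = D w\<close>, and \<open>g = \<phi> / sqrt D\<close> has
  \<open>g(0) = 1 / sqrt D\<close>. An \<open>L^2\<close> minimization over polynomials thus takes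
  the place of the outer function built from \<open>log w\<close> and its conjugate function. The
  loss is quadratic because the first-order term of \<open>1 / w\<close> has mean zero, and a linear
  loss would be useless: the bound for \<open>T_u\<close> appears only after division by
  \<open>\<delta>\<close>. The constant \<open>a\<close> is split off because no nonempty block
  makes a multiple of the identity small. The link between \<open>T_g\<close> and \<open>T_u\<close>
  enters as the inequality \<open>|T_g x|^2 \<le> |x|^2 + \<delta> <T_u x, x>\<close>, which is
  Bessel's inequality for \<open>g q\<close>; analyticity of \<open>g\<close> places
  \<open>g - a\<close> in \<open>Hinf0_circle\<close>. Normalizing the symbol requires its essential
  supremum to be at most the operator norm. For this, positivity is tested against
  \<open>|q|^2\<close> with \<open>q\<close> a polynomial, and the same test yields the uniqueness
  of Fourier coefficients that makes \<open>|\<phi>|^2 / w\<close> constant.\<close>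

lemma coord_simps [simp]:
  "coord (x + y) i = coord x i + coord y i"
  "coord (x - y) i = coord x i - coord y i"
  "coord (- x) i = - coord x i"
  "coord 0 i = 0"
  "coord (r *\<^sub>R x) i = of_real r * coord x i"
  "coord (diag_proj A x) i = (if i \<in> A then coord x i else 0)"
  by (simp_all add: plus_ell2.rep_eq minus_ell2.rep_eq uminus_ell2.rep_eq zero_ell2.rep_eq
      scaleR_ell2.rep_eq diag_proj.rep_eq)

lemma ell2_eqI: "(\<And>i. coord x i = coord y i) \<Longrightarrow> x = y"
  by (metis coord_inject ext)

lemma coord_Abs_ell2: "summable (\<lambda>i. (cmod (f i))\<^sup>2) \<Longrightarrow> coord (Abs_ell2 f) = f"
  by (simp add: Abs_ell2_inverse)

lemma norm_ell2_power2: "(norm x)\<^sup>2 = (\<Sum>i. (cmod (coord x i))\<^sup>2)"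
  by (simp add: norm_ell2_def suminf_nonneg summable_coord)

lemma sum_coord_le_norm: "finite I \<Longrightarrow> (\<Sum>i\<in>I. (cmod (coord x i))\<^sup>2) \<le> (norm x)\<^sup>2"
  unfolding norm_ell2_power2 by (intro sum_le_suminf summable_coord) auto

lemma norm_ell2_leI:
  assumes "\<And>K. (\<Sum>i<K. (cmod (coord x i))\<^sup>2) \<le> c\<^sup>2" "0 \<le> c"
  shows "norm x \<le> c"
proof -
  have "(norm x)\<^sup>2 \<le> c\<^sup>2"
    unfolding norm_ell2_power2 by (intro suminf_le_const summable_coord assms)
  then show ?thesis using assms(2) by (rule power2_le_imp_le)
qed

lemma Re_cinner: "Re (cinner x y) = inner x y"
  by (simp add: inner_ell2_def)

text \<open>Cauchy-Schwarz for the real inner product controls only the real part of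
  \<open>cinner\<close>; the modulus is bounded on partial sums and then in the limit. The purpose
  is continuity of \<open>cinner\<close> in its second argument.\<close>

lemma cmod_cinner_le: "cmod (cinner x y) \<le> norm x * norm y"
proof -
  have L2: "L2_set (\<lambda>i. cmod (coord u i)) {..<n} \<le> norm u" for u n
    using sum_coord_le_norm[of "{..<n}" u] by (simp add: L2_set_def real_le_lsqrt)
  have "cmod (\<Sum>i<n. coord x i * cnj (coord y i)) \<le> norm x * norm y" for n
  proof -
    have "cmod (\<Sum>i<n. coord x i * cnj (coord y i)) \<le> (\<Sum>i<n. \<bar>cmod (coord x i)\<bar> * \<bar>cmod (coord y i)\<bar>)"
      by (rule order_trans[OF norm_sum]) (simp add: norm_mult)
    also have "\<dots> \<le> L2_set (\<lambda>i. cmod (coord x i)) {..<n} * L2_set (\<lambda>i. cmod (coord y i)) {..<n}"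
      by (rule L2_set_mult_ineq)
    also have "\<dots> \<le> norm x * norm y"
      by (intro mult_mono L2) auto
    finally show ?thesis .
  qed
  moreover have "(\<lambda>n. cmod (\<Sum>i<n. coord x i * cnj (coord y i))) \<longlonglongrightarrow> cmod (cinner x y)"
    unfolding cinner_def by (intro tendsto_norm summable_LIMSEQ summable_cinner)
  ultimately show ?thesis by (blast intro: LIMSEQ_le_const2)
qed

lemma cinner_diff_right: "cinner x (y - z) = cinner x y - cinner x z"
  by (simp add: cinner_def suminf_diff[OF summable_cinner summable_cinner] algebra_simps)

lemma tendsto_cinner_right:
  assumes "X \<longlonglongrightarrow> y"
  shows "(\<lambda>n. cinner x (X n)) \<longlonglongrightarrow> cinner x y"
proof (rule LIM_zero_cancel, rule Lim_null_comparison)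
  show "\<forall>\<^sub>F n in sequentially. cmod (cinner x (X n) - cinner x y) \<le> norm x * norm (X n - y)"
    by (intro always_eventually allI) (metis cinner_diff_right cmod_cinner_le)
  show "(\<lambda>n. norm x * norm (X n - y)) \<longlonglongrightarrow> 0"
    using assms by (auto intro!: tendsto_eq_intros simp: LIM_zero tendsto_norm_zero)
qed

lemma norm_diag_proj_le: "norm (diag_proj A x) \<le> norm x"
  by (rule norm_ell2_leI)
     (auto intro!: order_trans[OF sum_mono sum_coord_le_norm[of _ x]])

lemma bounded_linear_diag_proj: "bounded_linear (diag_proj A)"
  by (rule bounded_linear_intro[of _ 1])
     (auto intro!: ell2_eqI simp: norm_diag_proj_le)

lemma diag_proj_diag_proj: "diag_proj A (diag_proj B x) = diag_proj (A \<inter> B) x"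
  by (rule ell2_eqI) auto

text \<open>The squared distance is a tail of the convergent norm series. Truncations commute with
  every \<open>diag_proj A\<close>, so this density statement can be used inside a block.\<close>

lemma diag_proj_lessThan_tendsto: "(\<lambda>n. diag_proj {..<n} x) \<longlonglongrightarrow> x"
proof -
  have eq: "(norm (x - diag_proj {..<n} x))\<^sup>2 = (norm x)\<^sup>2 - (\<Sum>i<n. (cmod (coord x i))\<^sup>2)" for n
  proof -
    have "(norm x)\<^sup>2 = (\<Sum>i. (cmod (coord x (i + n)))\<^sup>2) + (\<Sum>i<n. (cmod (coord x i))\<^sup>2)"
      unfolding norm_ell2_power2 by (rule suminf_split_initial_segment[OF summable_coord])
    moreover have "(norm (x - diag_proj {..<n} x))\<^sup>2
        = (\<Sum>i. (cmod (coord (x - diag_proj {..<n} x) (i + n)))\<^sup>2)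
          + (\<Sum>i<n. (cmod (coord (x - diag_proj {..<n} x) i))\<^sup>2)"
      unfolding norm_ell2_power2 by (rule suminf_split_initial_segment[OF summable_coord])
    ultimately show ?thesis by simp
  qed
  have "(\<lambda>n. (norm x)\<^sup>2 - (\<Sum>i<n. (cmod (coord x i))\<^sup>2)) \<longlonglongrightarrow> (norm x)\<^sup>2 - (norm x)\<^sup>2"
    unfolding norm_ell2_power2 by (intro tendsto_intros summable_LIMSEQ summable_coord)
  then have "(\<lambda>n. sqrt ((norm (x - diag_proj {..<n} x))\<^sup>2)) \<longlonglongrightarrow> sqrt 0"
    unfolding eq by (intro tendsto_real_sqrt) simp
  then have "(\<lambda>n. norm (diag_proj {..<n} x - x)) \<longlonglongrightarrow> 0"
    by (simp add: norm_minus_commute)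
  then show ?thesis by (simp add: LIM_zero_cancel tendsto_norm_zero_iff)
qed

text \<open>A polynomial plays two roles: its coefficients form a finitely supported vector, and
  \<open>poly q (cis t)\<close> is the function on the circle with these Fourier coefficients.
  Relations between operators and integrals are proved on polynomials first.\<close>

lift_definition ell2_of_poly :: "complex poly \<Rightarrow> ell2" is coeff
proof -
  fix p :: "complex poly"
  show "summable (\<lambda>i. (cmod (coeff p i))\<^sup>2)"
    by (rule summable_finite[of "{..degree p}"]) (auto simp: coeff_eq_0)
qed

lemma coord_ell2_of_poly [simp]: "coord (ell2_of_poly p) = coeff p"
  by (rule ell2_of_poly.rep_eq)

lemma diag_proj_lessThan_poly: "\<exists>p. diag_proj {..<n} x = ell2_of_poly p"
proof
  show "diag_proj {..<n} x = ell2_of_poly (\<Sum>j<n. monom (coord x j) j)"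
    by (rule ell2_eqI) (auto simp: coeff_sum)
qed

lemma norm_ell2_of_poly: "(norm (ell2_of_poly p))\<^sup>2 = (\<Sum>j\<le>degree p. (cmod (coeff p j))\<^sup>2)"
  unfolding norm_ell2_power2 by (simp, rule suminf_finite) (auto simp: coeff_eq_0)

text \<open>Only real scalars act on \<open>ell2\<close> as a vector space, so multiplication by the
  imaginary unit is an operator of its own. It reassembles an operator from the parts given by the
  real and imaginary parts of its symbol.\<close>

lift_definition imult :: "ell2 \<Rightarrow> ell2" is "\<lambda>x i. \<i> * x i"
  by (simp add: norm_mult)

lemma coord_imult [simp]: "coord (imult x) i = \<i> * coord x i"
  by (simp add: imult.rep_eq)

lemma norm_imult [simp]: "norm (imult x) = norm x"
  by (simp add: norm_ell2_def norm_mult)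

text \<open>Polarization turns the bound on the form into a bound on \<open>inner (T x) y\<close>,
  and the parallelogram law evaluates the right-hand side. The form is the real one, so complex
  self-adjoint operators are covered through their real parts.\<close>

lemma norm_le_of_quadratic_form:
  fixes T :: "'a::real_inner \<Rightarrow> 'a"
  assumes "linear T" and sym: "\<And>x y. inner (T x) y = inner x (T y)"
    and quad: "\<And>x. \<bar>inner (T x) x\<bar> \<le> c * (norm x)\<^sup>2"
  shows "norm (T x) \<le> c * norm x"
proof (cases "T x = 0 \<or> x = 0")
  case True
  have "0 \<le> c" if "x \<noteq> 0"
  proof -
    have "0 \<le> c * (norm x)\<^sup>2" using quad[of x] by linarith
    then show ?thesis using that by (simp add: zero_le_mult_iff)
  qed
  then show ?thesis
    using True linear_0[OF assms(1)] by (cases "x = 0") auto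
next
  case False
  \<comment> \<open>The multiple of \<open>T x\<close> with the length of \<open>x\<close>: the
    parallelogram law then gives \<open>4 * (norm x)^2\<close>, and \<open>inner (T x) y\<close> is
    the product of the norms.\<close>
  define y where "y = (norm x / norm (T x)) *\<^sub>R T x"
  have ny: "norm y = norm x" using False by (simp add: y_def)
  have "4 * inner (T x) y = inner (T (x + y)) (x + y) - inner (T (x - y)) (x - y)"
    using sym[of x y] by (simp add: linear_add[OF assms(1)] linear_diff[OF assms(1)]
        inner_add_left inner_add_right inner_diff_left inner_diff_right inner_commute)
  also have "\<dots> \<le> c * (norm (x + y))\<^sup>2 + c * (norm (x - y))\<^sup>2"
    using quad[of "x + y"] quad[of "x - y"] by linarith
  also have "\<dots> = 4 * c * (norm x)\<^sup>2"
  proof -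
    have "(norm (x + y))\<^sup>2 + (norm (x - y))\<^sup>2 = 2 * (norm x)\<^sup>2 + 2 * (norm y)\<^sup>2"
      by (simp add: power2_norm_eq_inner inner_add_left inner_add_right inner_diff_left
          inner_diff_right inner_commute)
    then show ?thesis unfolding ny by (simp add: algebra_simps flip: distrib_left)
  qed
  finally have "inner (T x) y \<le> c * norm x * norm x"
    by (simp add: power2_eq_square)
  moreover have "inner (T x) y = norm (T x) * norm x"
    using False by (simp add: y_def power2_eq_square flip: power2_norm_eq_inner)
  ultimately show ?thesis using False by simp
qed

section \<open>Pavings and compressions\<close>

text \<open>Two operators are paved at once by intersecting blocks, because compressing further to a
  subset cannot increase a norm. Pairs \<open>(i, j)\<close> are numbered row by row; the shifts by
  one come from blocks being numbered from 1.\<close>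

lemma paving_common_refinement:
  assumes "paving r A" "paving s B"
  shows "\<exists>C. paving (r * s) C \<and> (\<forall>k\<in>{1..r * s}. \<exists>i\<in>{1..r}. \<exists>j\<in>{1..s}. C k = A i \<inter> B j)"
proof -
  define I where "I k = Suc ((k - 1) div s)" for k
  define J where "J k = Suc ((k - 1) mod s)" for k
  have UA: "(\<Union>i\<in>{1..r}. A i) = UNIV" and UB: "(\<Union>i\<in>{1..s}. B i) = UNIV"
    using assms by (auto simp: paving_def)
  then have s: "s > 0" by (cases s) auto
  have IJ: "I k \<in> {1..r}" "J k \<in> {1..s}" if "k \<in> {1..r * s}" for k
  proof -
    have "(k - 1) div s < r" using that s by (intro div_less_iff_less_mult[THEN iffD2]) auto
    then show "I k \<in> {1..r}" by (simp add: I_def)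
    show "J k \<in> {1..s}" using s by (simp add: J_def Suc_leI)
  qed
  have inj: "k = l" if "I k = I l" "J k = J l" "k \<ge> 1" "l \<ge> 1" for k l
  proof -
    have "k - 1 = l - 1"
      using that by (metis I_def J_def Suc_inject div_mult_mod_eq)
    then show ?thesis using that by linarith
  qed
  have surj: "\<exists>k\<in>{1..r * s}. I k = i \<and> J k = j" if "i \<in> {1..r}" "j \<in> {1..s}" for i j
  proof
    let ?k = "Suc ((i - 1) * s + (j - 1))"
    have "j - 1 < s" using that s by auto
    then have "((i - 1) * s + (j - 1)) div s = i - 1" "((i - 1) * s + (j - 1)) mod s = j - 1"
      by simp_all
    then show "I ?k = i \<and> J ?k = j"
      unfolding I_def J_def using that by (simp only: diff_Suc_1) auto
    have "(i - 1) * s + s = i * s" using that by (cases i) auto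
    also have "\<dots> \<le> r * s" using that by simp
    finally have "(i - 1) * s + s \<le> r * s" .
    then show "?k \<in> {1..r * s}" using that by auto
  qed
  define C where "C k = A (I k) \<inter> B (J k)" for k
  have "disjoint_family_on C {1..r * s}"
    unfolding disjoint_family_on_def
  proof (intro ballI impI)
    fix k l assume kl: "k \<in> {1..r * s}" "l \<in> {1..r * s}" "k \<noteq> l"
    then have "I k \<noteq> I l \<or> J k \<noteq> J l" using inj by auto
    then have "A (I k) \<inter> A (I l) = {} \<or> B (J k) \<inter> B (J l) = {}"
      using assms IJ[OF kl(1)] IJ[OF kl(2)] unfolding paving_def disjoint_family_on_def by blast
    then show "C k \<inter> C l = {}" by (auto simp: C_def)
  qed
  moreover have "(\<Union>k\<in>{1..r * s}. C k) = UNIV"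
  proof -
    have "n \<in> (\<Union>k\<in>{1..r * s}. C k)" for n
    proof -
      obtain i j where ij: "i \<in> {1..r}" "n \<in> A i" "j \<in> {1..s}" "n \<in> B j"
        using UA UB by blast
      then obtain k where "k \<in> {1..r * s}" "I k = i" "J k = j"
        using surj by blast
      then show ?thesis using ij by (auto simp: C_def)
    qed
    then show ?thesis by blast
  qed
  ultimately have "paving (r * s) C"
    by (simp add: paving_def)
  moreover have "\<forall>k\<in>{1..r * s}. \<exists>i\<in>{1..r}. \<exists>j\<in>{1..s}. C k = A i \<inter> B j"
    using IJ unfolding C_def by blast
  ultimately show ?thesis by blast
qed

text \<open>Replacing \<open>x\<close> by its projection leaves the value of the compression
  unchanged and does not increase the norm of the argument, so vectors supported in the block
  decide.\<close>

lemma onorm_compression_le: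
  assumes "\<And>x. diag_proj A x = x \<Longrightarrow> norm (diag_proj A (T x)) \<le> c * norm x" "0 \<le> c"
  shows "onorm (diag_proj A \<circ> T \<circ> diag_proj A) \<le> c"
proof (rule onorm_bound[OF assms(2)])
  fix x
  have "norm (diag_proj A (T (diag_proj A x))) \<le> c * norm (diag_proj A x)"
    by (rule assms(1)) (simp add: diag_proj_diag_proj)
  also have "\<dots> \<le> c * norm x"
    by (intro mult_left_mono norm_diag_proj_le assms(2))
  finally show "norm ((diag_proj A \<circ> T \<circ> diag_proj A) x) \<le> c * norm x" by simp
qed

lemma norm_compression_le:
  assumes "bounded_linear T" "diag_proj A x = x"
  shows "norm (diag_proj A (T x)) \<le> onorm (diag_proj A \<circ> T \<circ> diag_proj A) * norm x"
proof -
  have "bounded_linear (diag_proj A \<circ> T \<circ> diag_proj A)"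
    unfolding comp_def
    by (intro bounded_linear_compose[OF bounded_linear_diag_proj] 
        bounded_linear_compose[OF assms(1)] bounded_linear_diag_proj)
  from onorm[OF this, of x] show ?thesis using assms(2) by simp
qed

section \<open>Essentially bounded functions and their Fourier coefficients\<close>

abbreviation circ :: "real measure" where
  "circ \<equiv> lebesgue_on {0..2*pi}"

interpretation circ: finite_measure circ
  by (rule finite_measure_lebesgue_on) simp

text \<open>One predicate for real and complex functions of the angle. Its closure under sums,
  products, conjugation and real parts discharges the integrability of the expressions in symbols
  and polynomials below.\<close>

definition ess_bdd :: "(real \<Rightarrow> 'a::{real_normed_field,banach,second_countable_topology}) \<Rightarrow> bool" where
  "ess_bdd G \<longleftrightarrow> G \<in> borel_measurable circ \<and> (\<exists>C. AE t in circ. norm (G t) \<le> C)"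

lemma Linf_circle_iff: "f \<in> Linf_circle \<longleftrightarrow> ess_bdd (\<lambda>t. f (cis t))"
  by (simp add: Linf_circle_def ess_bdd_def)

lemma ess_bddI: "G \<in> borel_measurable circ \<Longrightarrow> AE t in circ. norm (G t) \<le> C \<Longrightarrow> ess_bdd G"
  by (auto simp: ess_bdd_def)

lemma ess_bdd_measurable: "ess_bdd G \<Longrightarrow> G \<in> borel_measurable circ"
  by (simp add: ess_bdd_def)

lemma ess_bdd_integrable: "ess_bdd G \<Longrightarrow> integrable circ G"
  unfolding ess_bdd_def using circ.integrable_const_bound by blast

lemma ess_bdd_continuous:
  assumes "continuous_on {0..2*pi} G"
  shows "ess_bdd G"
proof -
  have "bounded (G ` {0..2*pi})"
    using assms by (intro compact_imp_bounded compact_continuous_image) auto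
  then obtain C where "\<And>t. t \<in> {0..2*pi} \<Longrightarrow> norm (G t) \<le> C"
    unfolding bounded_iff by blast
  then have "AE t in circ. norm (G t) \<le> C" by (intro AE_I2) simp
  moreover have "G \<in> borel_measurable circ"
    using assms by (intro continuous_imp_measurable_on_sets_lebesgue) auto
  ultimately show ?thesis by (rule ess_bddI[rotated])
qed

lemma ess_bdd_const [intro!, simp]: "ess_bdd (\<lambda>t. c)"
  by (intro ess_bdd_continuous continuous_intros)

lemma ess_bdd_add [intro!]:
  assumes "ess_bdd F" "ess_bdd G" shows "ess_bdd (\<lambda>t. F t + G t)"
proof -
  from assms obtain C D where "AE t in circ. norm (F t) \<le> C" "AE t in circ. norm (G t) \<le> D"
    by (auto simp: ess_bdd_def)
  then have "AE t in circ. norm (F t + G t) \<le> C + D"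
    by eventually_elim (rule norm_triangle_mono)
  then show ?thesis using assms by (intro ess_bddI) (auto simp: ess_bdd_def)
qed

lemma ess_bdd_mult [intro!]:
  assumes "ess_bdd F" "ess_bdd G" shows "ess_bdd (\<lambda>t. F t * G t)"
proof -
  from assms obtain C D where "AE t in circ. norm (F t) \<le> C" "AE t in circ. norm (G t) \<le> D"
    by (auto simp: ess_bdd_def)
  then have "AE t in circ. norm (F t * G t) \<le> C * D"
    by eventually_elim
       (auto simp: norm_mult intro!: mult_mono intro: order_trans[OF norm_ge_zero])
  then show ?thesis using assms by (intro ess_bddI) (auto simp: ess_bdd_def)
qed

lemma ess_bdd_uminus [intro!]: "ess_bdd F \<Longrightarrow> ess_bdd (\<lambda>t. - F t)"
  by (simp add: ess_bdd_def)

lemma ess_bdd_diff [intro!]: "ess_bdd F \<Longrightarrow> ess_bdd G \<Longrightarrow> ess_bdd (\<lambda>t. F t - G t)"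
  using ess_bdd_add[of F "\<lambda>t. - G t"] by auto

lemma ess_bdd_norm_le:
  assumes "ess_bdd F" "G \<in> borel_measurable circ" "\<And>t. norm (G t) \<le> norm (F t)"
  shows "ess_bdd G"
proof -
  from assms obtain C where "AE t in circ. norm (F t) \<le> C"
    by (auto simp: ess_bdd_def)
  then have "AE t in circ. norm (G t) \<le> C"
    by eventually_elim (metis assms(3) order_trans)
  then show ?thesis by (rule ess_bddI[OF assms(2)])
qed

lemma ess_bdd_cnj [intro!]: "ess_bdd F \<Longrightarrow> ess_bdd (\<lambda>t. cnj (F t))"
  by (rule ess_bdd_norm_le[of F])
     (auto simp: ess_bdd_def intro!: borel_measurable_continuous_on[of cnj] continuous_intros)

lemma ess_bdd_Re [intro!]: "ess_bdd F \<Longrightarrow> ess_bdd (\<lambda>t. Re (F t))"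
  by (rule ess_bdd_norm_le[of F])
     (auto simp: ess_bdd_def abs_Re_le_cmod intro!: borel_measurable_Re[THEN measurable_compose[rotated]])

lemma ess_bdd_Im [intro!]: "ess_bdd F \<Longrightarrow> ess_bdd (\<lambda>t. Im (F t))"
  by (rule ess_bdd_norm_le[of F])
     (auto simp: ess_bdd_def abs_Im_le_cmod intro!: borel_measurable_Im[THEN measurable_compose[rotated]])

lemma ess_bdd_of_real [intro!]: "ess_bdd F \<Longrightarrow> ess_bdd (\<lambda>t. complex_of_real (F t))"
  by (rule ess_bdd_norm_le[of "\<lambda>t. F t"])
     (auto simp: ess_bdd_def)

lemma ess_bdd_cmod [intro!]: "ess_bdd F \<Longrightarrow> ess_bdd (\<lambda>t. cmod (F t))"
  by (auto simp: ess_bdd_def)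

lemma ess_bdd_power2 [intro!]: "ess_bdd F \<Longrightarrow> ess_bdd (\<lambda>t. (F t)\<^sup>2)"
  unfolding power2_eq_square by auto

lemma ess_bdd_cis [intro!, simp]: "ess_bdd (\<lambda>t. cis (c * t))" "ess_bdd (\<lambda>t. cis (- (c * t)))"
  by (intro ess_bdd_continuous continuous_intros)+

lemma ess_bdd_poly [intro!, simp]: "ess_bdd (\<lambda>t. poly q (cis t))"
  by (intro ess_bdd_continuous continuous_intros)

section \<open>Orthogonality of the characters, Fourier coefficients and Bessel's inequality\<close>

lemma integral_circ_cis: "(LINT t|circ. cis (of_int n * t)) = (if n = 0 then 2 * pi else 0)"
proof (cases "n = 0")
  case False
  have der: "((\<lambda>t. cis (of_int n * t) / (\<i> * of_int n)) has_vector_derivative cis (of_int n * t))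
      (at t within {0..2*pi})" for t
    unfolding has_vector_derivative_def
    using False by (auto intro!: derivative_eq_intros simp: fun_eq_iff scaleR_conv_of_real field_simps)
  have "((\<lambda>t. cis (of_int n * t)) has_integral
      cis (of_int n * (2*pi)) / (\<i> * of_int n) - cis (of_int n * 0) / (\<i> * of_int n)) {0..2*pi}"
    by (intro fundamental_theorem_of_calculus der) auto
  moreover have "cis (of_int n * (2*pi)) = 1"
    by (metis cis_multiple_2pi Ints_of_int mult.commute)
  ultimately have "((\<lambda>t. cis (of_int n * t)) has_integral 0) {0..2*pi}" by simp
  then show ?thesis
    using False lebesgue_integral_eq_integral[OF ess_bdd_integrable[OF ess_bdd_cis(1)], of "of_int n"]
    by (simp add: integral_unique)
qed (simp add: scaleR_conv_of_real measure_restrict_space)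

text \<open>The counterpart of \<open>fourier_coeff\<close> for functions of the angle, so that
  products with polynomials and characters need not be written as functions of a complex
  variable.\<close>

definition fcoeff :: "(real \<Rightarrow> complex) \<Rightarrow> int \<Rightarrow> complex" where
  "fcoeff G n = 1 / (2*pi) * (LINT t|circ. G t * cis (- (of_int n * t)))"

lemma fourier_coeff_eq: "fourier_coeff f n = fcoeff (\<lambda>t. f (cis t)) n"
  by (simp add: fourier_coeff_def fcoeff_def)

lemma fcoeff_const: "fcoeff (\<lambda>t. c) n = (if n = 0 then c else 0)"
  using integral_circ_cis[of "- n"] by (simp add: fcoeff_def)

lemma fcoeff_add: "ess_bdd F \<Longrightarrow> ess_bdd G \<Longrightarrow> fcoeff (\<lambda>t. F t + G t) n = fcoeff F n + fcoeff G n"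
  unfolding fcoeff_def distrib_right
  by (subst Bochner_Integration.integral_add) (auto intro!: ess_bdd_integrable simp: distrib_left)

lemma fcoeff_cmult: "fcoeff (\<lambda>t. c * F t) n = c * fcoeff F n"
  by (simp add: fcoeff_def mult.assoc)

lemma fcoeff_diff: "ess_bdd F \<Longrightarrow> ess_bdd G \<Longrightarrow> fcoeff (\<lambda>t. F t - G t) n = fcoeff F n - fcoeff G n"
  using fcoeff_add[of F "\<lambda>t. (-1) * G t" n] fcoeff_cmult[of "-1" G n] by fastforce

lemma fcoeff_cnj: "fcoeff (\<lambda>t. cnj (F t)) n = cnj (fcoeff F (- n))"
proof -
  have "(LINT t|circ. cnj (F t) * cis (- (of_int n * t)))
      = (LINT t|circ. cnj (F t * cis (- (of_int (- n) * t))))"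
    by (simp add: cis_cnj)
  also have "\<dots> = cnj (LINT t|circ. F t * cis (- (of_int (- n) * t)))"
    by (rule Bochner_Integration.integral_cnj)
  finally show ?thesis by (simp add: fcoeff_def)
qed

lemma fcoeff_cis: "fcoeff (\<lambda>t. F t * cis (of_int k * t)) n = fcoeff F (n - k)"
  by (simp add: fcoeff_def mult.assoc cis_mult algebra_simps)

lemma cis_power_int: "cis t ^ j = cis (of_int (int j) * t)"
  by (simp only: Complex.DeMoivre of_int_of_nat_eq)

text \<open>Multiplication by \<open>z^j\<close> shifts Fourier coefficients by \<open>j\<close>.
  For \<open>n = int i\<close> the finite convolution is row \<open>i\<close> of the Toeplitz matrix
  applied to the coefficients of \<open>q\<close>.\<close>

lemma fcoeff_poly:
  assumes "ess_bdd G"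
  shows "fcoeff (\<lambda>t. G t * poly q (cis t)) n = (\<Sum>j\<le>degree q. coeff q j * fcoeff G (n - int j))"
proof -
  have "(LINT t|circ. G t * poly q (cis t) * cis (- (of_int n * t)))
      = (LINT t|circ. (\<Sum>j\<le>degree q. coeff q j * (G t * cis (of_int (int j) * t) * cis (- (of_int n * t)))))"
    by (simp only: poly_altdef cis_power_int sum_distrib_left sum_distrib_right mult_ac)
  also have "\<dots> = (\<Sum>j\<le>degree q. coeff q j * (LINT t|circ. G t * cis (of_int (int j) * t) * cis (- (of_int n * t))))"
    using assms
    by (subst Bochner_Integration.integral_sum) (auto intro!: ess_bdd_integrable simp del: of_int_of_nat_eq)
  finally have "fcoeff (\<lambda>t. G t * poly q (cis t)) n
      = (\<Sum>j\<le>degree q. coeff q j * fcoeff (\<lambda>t. G t * cis (of_int (int j) * t)) n)"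
    by (simp add: fcoeff_def sum_distrib_left mult_ac del: of_int_of_nat_eq)
  then show ?thesis by (simp only: fcoeff_cis)
qed

lemma fcoeff_poly_1: "fcoeff (\<lambda>t. poly q (cis t)) n = (if n < 0 then 0 else coeff q (nat n))"
proof -
  have "fcoeff (\<lambda>t. poly q (cis t)) n = (\<Sum>j\<le>degree q. if j = nat n \<and> 0 \<le> n then coeff q j else 0)"
    using fcoeff_poly[of "\<lambda>t. 1" q n] by (auto simp: fcoeff_const intro!: sum.cong)
  also have "\<dots> = (if n < 0 then 0 else coeff q (nat n))"
    by (auto simp: coeff_eq_0 not_le)
  finally show ?thesis .
qed

text \<open>Parseval's formula with a polynomial as one factor: only the finitely many frequencies
  of \<open>q\<close> contribute, so no convergence of Fourier series is involved.\<close>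

lemma integral_mult_cnj_poly:
  assumes "ess_bdd G"
  shows "(LINT t|circ. G t * cnj (poly q (cis t))) = 2 * pi * (\<Sum>j\<le>degree q. cnj (coeff q j) * fcoeff G (int j))"
proof -
  have "(LINT t|circ. G t * cnj (poly q (cis t)))
      = (LINT t|circ. (\<Sum>j\<le>degree q. cnj (coeff q j) * (G t * cis (- (of_int (int j) * t)))))"
    by (simp add: poly_altdef cis_power_int cis_cnj sum_distrib_left mult_ac del: of_int_of_nat_eq)
  also have "\<dots> = (\<Sum>j\<le>degree q. cnj (coeff q j) * (LINT t|circ. G t * cis (- (of_int (int j) * t))))"
    using assms
    by (subst Bochner_Integration.integral_sum) (auto intro!: ess_bdd_integrable simp del: of_int_of_nat_eq)
  finally show ?thesis
    by (simp add: fcoeff_def sum_distrib_left mult_ac del: of_int_of_nat_eq)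
qed

lemma integral_cmod_poly_power2:
  "(LINT t|circ. (cmod (poly q (cis t)))\<^sup>2) = 2 * pi * (norm (ell2_of_poly q))\<^sup>2"
proof -
  have "complex_of_real (LINT t|circ. (cmod (poly q (cis t)))\<^sup>2)
      = (LINT t|circ. poly q (cis t) * cnj (poly q (cis t)))"
    unfolding complex_norm_square[symmetric] by (rule integral_complex_of_real[symmetric])
  also have "\<dots> = complex_of_real (2 * pi * (norm (ell2_of_poly q))\<^sup>2)"
    unfolding integral_mult_cnj_poly[OF ess_bdd_poly]
    by (simp add: fcoeff_poly_1 norm_ell2_of_poly complex_norm_square mult.commute[of "cnj _"]
        del: of_real_power)
  finally show ?thesis by (simp only: of_real_eq_iff)
qed

lemma bessel_inequality:
  assumes G: "ess_bdd G"
  shows "(\<Sum>i<K. (cmod (fcoeff G (int i)))\<^sup>2) \<le> 1 / (2*pi) * (LINT t|circ. (cmod (G t))\<^sup>2)"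
proof -
  \<comment> \<open>The orthogonal projection of \<open>G\<close> onto polynomials of degree below
    \<open>K\<close>; expanding the nonnegative integral of \<open>|G - q|^2\<close> gives the
    inequality.\<close>
  define q where "q = (\<Sum>i<K. monom (fcoeff G (int i)) i)"
  have cq: "coeff q i = (if i < K then fcoeff G (int i) else 0)" for i
    by (auto simp: q_def coeff_sum)
  have nq: "(norm (ell2_of_poly q))\<^sup>2 = (\<Sum>i<K. (cmod (fcoeff G (int i)))\<^sup>2)" (is "_ = ?S")
    unfolding norm_ell2_power2 by (subst suminf_finite[of "{..<K}"]) (auto simp: cq)
  have "(LINT t|circ. G t * cnj (poly q (cis t))) = complex_of_real (2 * pi) * (\<Sum>j\<le>degree q. complex_of_real ((cmod (coeff q j))\<^sup>2))"
    unfolding integral_mult_cnj_poly[OF G]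
    by (intro arg_cong2[where f="(*)"] refl sum.cong)
       (auto simp: cq complex_norm_square mult.commute simp del: of_real_power)
  also have "\<dots> = of_real (2 * pi * (norm (ell2_of_poly q))\<^sup>2)"
    by (simp add: norm_ell2_of_poly)
  finally have *: "(LINT t|circ. Re (G t * cnj (poly q (cis t)))) = 2 * pi * ?S"
    using G by (subst integral_Re) (auto simp: nq intro!: ess_bdd_integrable)
  have "0 \<le> (LINT t|circ. (cmod (G t - poly q (cis t)))\<^sup>2)" by simp
  also have "\<dots> = (LINT t|circ. (cmod (G t))\<^sup>2 - 2 * Re (G t * cnj (poly q (cis t))) + (cmod (poly q (cis t)))\<^sup>2)"
  proof (intro arg_cong[where f="integral\<^sup>L circ"] ext)
    show "(cmod (a - b))\<^sup>2 = (cmod a)\<^sup>2 - 2 * Re (a * cnj b) + (cmod b)\<^sup>2" for a b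
      unfolding cmod_power2 by (simp add: power2_eq_square algebra_simps)
  qed
  also have "\<dots> = (LINT t|circ. (cmod (G t))\<^sup>2) - 2 * (LINT t|circ. Re (G t * cnj (poly q (cis t))))
      + (LINT t|circ. (cmod (poly q (cis t)))\<^sup>2)"
    using G by (subst Bochner_Integration.integral_add Bochner_Integration.integral_diff,
      auto intro!: ess_bdd_integrable)+
  also have "\<dots> = (LINT t|circ. (cmod (G t))\<^sup>2) - 2 * pi * ?S"
    unfolding * integral_cmod_poly_power2 nq by simp
  finally show ?thesis by (simp add: field_simps)
qed

section \<open>Toeplitz operators with bounded symbol\<close>

text \<open>After a shift and a conjugation of the symbol, row \<open>i\<close> consists, up to
  conjugation, of coefficients at the nonnegative frequencies \<open>j\<close>. Bessel's inequality
  then makes the row square-summable.\<close>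

lemma summable_toeplitz_row:
  assumes "f \<in> Linf_circle"
  shows "summable (\<lambda>j. fourier_coeff f (int i - int j) * coord x j)"
proof -
  let ?G = "\<lambda>t. cnj (f (cis t) * cis (of_int (- int i) * t))"
  have G: "ess_bdd ?G"
    using assms by (auto simp: Linf_circle_iff simp del: of_int_minus)
  have fG: "fcoeff ?G (int j) = cnj (fourier_coeff f (int i - int j))" for j
    by (simp only: fcoeff_cnj fcoeff_cis fourier_coeff_eq) simp
  have "summable (\<lambda>j. (cmod (fourier_coeff f (int i - int j)))\<^sup>2)"
  proof (rule bounded_imp_summable)
    show "(\<Sum>j\<le>n. (cmod (fourier_coeff f (int i - int j)))\<^sup>2) \<le> 1 / (2*pi) * (LINT t|circ. (cmod (?G t))\<^sup>2)" for n
      using bessel_inequality[OF G, of "Suc n"] unfolding fG lessThan_Suc_atMost complex_mod_cnj .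
  qed auto
  moreover have "summable (\<lambda>j. (cmod (cnj (coord x j)))\<^sup>2)"
    by (simp add: summable_coord)
  ultimately have "summable (\<lambda>j. fourier_coeff f (int i - int j) * cnj (cnj (coord x j)))"
    by (rule summable_prod_sq)
  then show ?thesis by simp
qed

text \<open>The raw image sequence, available before it is known to be square-summable; the bounds
  proved on it justify \<open>Abs_ell2\<close> afterwards.\<close>

definition toeplitz_seq :: "(complex \<Rightarrow> complex) \<Rightarrow> ell2 \<Rightarrow> nat \<Rightarrow> complex" where
  "toeplitz_seq f x i = (\<Sum>j. fourier_coeff f (int i - int j) * coord x j)"

text \<open>On polynomials a Toeplitz operator multiplies by the symbol and drops the negative
  frequencies.\<close>

lemma toeplitz_seq_poly:
  assumes "f \<in> Linf_circle"
  shows "toeplitz_seq f (ell2_of_poly q) i = fcoeff (\<lambda>t. f (cis t) * poly q (cis t)) (int i)"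
proof -
  have "toeplitz_seq f (ell2_of_poly q) i
      = (\<Sum>j\<le>degree q. fourier_coeff f (int i - int j) * coeff q j)"
    unfolding toeplitz_seq_def by (simp, rule suminf_finite) (auto simp: coeff_eq_0)
  then show ?thesis
    using assms by (simp add: fcoeff_poly Linf_circle_iff fourier_coeff_eq mult.commute)
qed

lemma toeplitz_seq_poly_bound:
  assumes f: "f \<in> Linf_circle"
  shows "(\<Sum>i<K. (cmod (toeplitz_seq f (ell2_of_poly q) i))\<^sup>2)
    \<le> 1 / (2*pi) * (LINT t|circ. (cmod (f (cis t)))\<^sup>2 * (cmod (poly q (cis t)))\<^sup>2)"
proof -
  have "ess_bdd (\<lambda>t. f (cis t) * poly q (cis t))"
    using f by (auto simp: Linf_circle_iff)
  from bessel_inequality[OF this, of K] show ?thesis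
    by (simp add: toeplitz_seq_poly[OF f] norm_mult power_mult_distrib)
qed

text \<open>For polynomials this is Bessel's inequality followed by the pointwise bound on the
  symbol. For general \<open>x\<close> it is applied to truncations; with \<open>K\<close> fixed,
  only finitely many convergent rows pass to the limit.\<close>

lemma toeplitz_seq_bound:
  assumes f: "f \<in> Linf_circle" and C: "AE t in circ. cmod (f (cis t)) \<le> C" "0 \<le> C"
  shows "(\<Sum>i<K. (cmod (toeplitz_seq f x i))\<^sup>2) \<le> (C * norm x)\<^sup>2"
proof -
  have bd: "(\<Sum>i<K. (cmod (toeplitz_seq f (ell2_of_poly q) i))\<^sup>2) \<le> (C * norm (ell2_of_poly q))\<^sup>2" for q
  proof -
    have "(LINT t|circ. (cmod (f (cis t)))\<^sup>2 * (cmod (poly q (cis t)))\<^sup>2)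
        \<le> (LINT t|circ. C\<^sup>2 * (cmod (poly q (cis t)))\<^sup>2)"
    proof (rule integral_mono_AE)
      show "AE t in circ. (cmod (f (cis t)))\<^sup>2 * (cmod (poly q (cis t)))\<^sup>2 \<le> C\<^sup>2 * (cmod (poly q (cis t)))\<^sup>2"
        using C(1) by eventually_elim (auto intro!: mult_right_mono power_mono)
    qed (use f in \<open>auto simp: Linf_circle_iff intro!: ess_bdd_integrable\<close>)
    also have "\<dots> = 2 * pi * (C * norm (ell2_of_poly q))\<^sup>2"
      by (simp add: integral_cmod_poly_power2 power_mult_distrib)
    finally have "1 / (2*pi) * (LINT t|circ. (cmod (f (cis t)))\<^sup>2 * (cmod (poly q (cis t)))\<^sup>2)
        \<le> (C * norm (ell2_of_poly q))\<^sup>2"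
      by (simp add: field_simps)
    then show ?thesis using toeplitz_seq_poly_bound[OF f, of q K] by linarith
  qed
  have "(\<Sum>i<K. (cmod (\<Sum>j<n. fourier_coeff f (int i - int j) * coord x j))\<^sup>2) \<le> (C * norm x)\<^sup>2" for n
  proof -
    obtain q where q: "diag_proj {..<n} x = ell2_of_poly q"
      using diag_proj_lessThan_poly by blast
    have "toeplitz_seq f (ell2_of_poly q) i = (\<Sum>j<n. fourier_coeff f (int i - int j) * coord x j)" for i
      unfolding q[symmetric] toeplitz_seq_def by (subst suminf_finite[of "{..<n}"]) auto
    then have "(\<Sum>i<K. (cmod (\<Sum>j<n. fourier_coeff f (int i - int j) * coord x j))\<^sup>2)
        \<le> (C * norm (diag_proj {..<n} x))\<^sup>2"
      using bd[of q] q by simp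
    also have "\<dots> \<le> (C * norm x)\<^sup>2"
      using C(2) by (intro power_mono mult_left_mono norm_diag_proj_le) auto
    finally show ?thesis .
  qed
  moreover have "(\<lambda>n. \<Sum>i<K. (cmod (\<Sum>j<n. fourier_coeff f (int i - int j) * coord x j))\<^sup>2)
      \<longlonglongrightarrow> (\<Sum>i<K. (cmod (toeplitz_seq f x i))\<^sup>2)"
    unfolding toeplitz_seq_def
    by (intro tendsto_intros summable_LIMSEQ summable_toeplitz_row f)
  ultimately show ?thesis by (intro LIMSEQ_le_const2) auto
qed

lemma coord_toeplitz:
  assumes f: "f \<in> Linf_circle"
  shows "coord (toeplitz f x) i = (\<Sum>j. fourier_coeff f (int i - int j) * coord x j)"
proof -
  obtain C where C: "AE t in circ. cmod (f (cis t)) \<le> C"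
    using f by (auto simp: Linf_circle_def)
  have "AE t in circ. cmod (f (cis t)) \<le> max C 0"
    using C by eventually_elim auto
  then have "(\<Sum>i\<le>n. (cmod (toeplitz_seq f x i))\<^sup>2) \<le> (max C 0 * norm x)\<^sup>2" for n
    using toeplitz_seq_bound[OF f, of "max C 0" _ "Suc n"] unfolding lessThan_Suc_atMost by simp
  then have "summable (\<lambda>i. (cmod (toeplitz_seq f x i))\<^sup>2)"
    by (intro bounded_imp_summable) auto
  then have "coord (Abs_ell2 (toeplitz_seq f x)) = toeplitz_seq f x"
    by (rule coord_Abs_ell2)
  moreover have "toeplitz f x = Abs_ell2 (toeplitz_seq f x)"
    by (simp add: toeplitz_def toeplitz_seq_def[abs_def])
  ultimately show ?thesis by (simp add: toeplitz_seq_def)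
qed

lemma coord_toeplitz_poly:
  assumes "f \<in> Linf_circle"
  shows "coord (toeplitz f (ell2_of_poly q)) i = fcoeff (\<lambda>t. f (cis t) * poly q (cis t)) (int i)"
  using toeplitz_seq_poly[OF assms, of q i] by (simp add: coord_toeplitz[OF assms] toeplitz_seq_def)

lemma norm_toeplitz_le:
  assumes "f \<in> Linf_circle" "AE t in circ. cmod (f (cis t)) \<le> C" "0 \<le> C"
  shows "norm (toeplitz f x) \<le> C * norm x"
  using toeplitz_seq_bound[OF assms]
  by (intro norm_ell2_leI) (auto simp: coord_toeplitz[OF assms(1)] toeplitz_seq_def assms(3))

text \<open>Dropping the negative frequencies of \<open>f q\<close> can only lower the norm. When
  \<open>|f|^2\<close> is a given weight, this bounds the image by the quadratic form of that
  weight.\<close>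

lemma norm_toeplitz_poly_power2_le:
  assumes "f \<in> Linf_circle"
  shows "(norm (toeplitz f (ell2_of_poly q)))\<^sup>2
    \<le> 1 / (2*pi) * (LINT t|circ. (cmod (f (cis t)))\<^sup>2 * (cmod (poly q (cis t)))\<^sup>2)"
  unfolding norm_ell2_power2
  using toeplitz_seq_poly_bound[OF assms, of q]
  by (intro suminf_le_const summable_coord) (simp add: coord_toeplitz[OF assms] toeplitz_seq_def)

lemma bounded_linear_toeplitz:
  assumes f: "f \<in> Linf_circle"
  shows "bounded_linear (toeplitz f)"
proof -
  obtain C where C: "AE t in circ. cmod (f (cis t)) \<le> C"
    using f by (auto simp: Linf_circle_def)
  have C': "AE t in circ. cmod (f (cis t)) \<le> max C 0"
    using C by eventually_elim auto
  note sm = summable_toeplitz_row[OF f]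
  show ?thesis
  proof (rule bounded_linear_intro)
    show "toeplitz f (x + y) = toeplitz f x + toeplitz f y" for x y
      using sm by (intro ell2_eqI) (simp add: coord_toeplitz[OF f] distrib_left suminf_add)
    show "toeplitz f (r *\<^sub>R x) = r *\<^sub>R toeplitz f x" for r x
      using sm by (intro ell2_eqI) (simp add: coord_toeplitz[OF f] mult.left_commute suminf_mult)
    show "norm (toeplitz f x) \<le> norm x * max C 0" for x
      using norm_toeplitz_le[OF f C', of x] by (simp add: mult.commute)
  qed
qed

text \<open>The dropped negative frequencies are orthogonal to the analytic polynomial
  \<open>q\<close>, so the pairing is the mean of the full product.\<close>

lemma cinner_toeplitz_poly:
  fixes f :: "complex \<Rightarrow> complex"
  assumes f: "f \<in> Linf_circle"
  shows "cinner (toeplitz f (ell2_of_poly q)) (ell2_of_poly q)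
    = 1 / (2*pi) * (LINT t|circ. f (cis t) * of_real ((cmod (poly q (cis t)))\<^sup>2))"
proof -
  have "cinner (toeplitz f (ell2_of_poly q)) (ell2_of_poly q)
      = (\<Sum>i\<le>degree q. cnj (coeff q i) * fcoeff (\<lambda>t. f (cis t) * poly q (cis t)) (int i))"
    unfolding cinner_def
    by (simp add: coord_toeplitz_poly[OF f] mult.commute, rule suminf_finite) (auto simp: coeff_eq_0)
  also have "\<dots> = 1 / (2*pi) * (LINT t|circ. f (cis t) * poly q (cis t) * cnj (poly q (cis t)))"
    using f by (subst integral_mult_cnj_poly) (auto simp: Linf_circle_iff)
  finally show ?thesis
    by (simp add: complex_norm_square mult.assoc del: of_real_power)
qed

section \<open>Dependence of the operator on its symbol, and self-adjointness\<close>

lemma toeplitz_coeffs_eqI: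
  assumes "\<And>n. fourier_coeff f n = fourier_coeff g n"
  shows "toeplitz f = toeplitz g"
  by (intro ext) (simp add: toeplitz_def assms)

text \<open>The relation is asked of Fourier coefficients only, and the conclusion is coordinatewise
  because \<open>a\<close> and \<open>b\<close> are complex.\<close>

lemma toeplitz_lin_comb:
  assumes f: "f \<in> Linf_circle" and g: "g \<in> Linf_circle" and h: "h \<in> Linf_circle"
    and "\<And>n. fourier_coeff h n = a * fourier_coeff f n + b * fourier_coeff g n"
  shows "coord (toeplitz h x) i = a * coord (toeplitz f x) i + b * coord (toeplitz g x) i"
  using summable_toeplitz_row[OF f, of i x] summable_toeplitz_row[OF g, of i x]
  by (simp add: coord_toeplitz f g h assms(4) distrib_right mult.assoc suminf_add[symmetric]
      summable_mult suminf_mult)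

lemma toeplitz_const:
  assumes "f \<in> Linf_circle" "\<And>n. fourier_coeff f n = (if n = 0 then a else 0)"
  shows "coord (toeplitz f x) i = a * coord x i"
  unfolding coord_toeplitz[OF assms(1)] assms(2)
  by (subst suminf_finite[of "{i}"]) auto

lemma self_adjoint_toeplitz_iff:
  assumes h: "h \<in> Linf_circle"
  shows "self_adjoint (toeplitz h) \<longleftrightarrow> (\<forall>n. fourier_coeff h (- n) = cnj (fourier_coeff h n))"
proof
  assume sym: "\<forall>n. fourier_coeff h (- n) = cnj (fourier_coeff h n)"
  \<comment> \<open>With a polynomial in the second argument one of the two sums is finite, so the
    order of summation can be exchanged; density and continuity of \<open>cinner\<close> extend the
    identity.\<close>
  have poly: "cinner (toeplitz h x) (ell2_of_poly q) = cinner x (toeplitz h (ell2_of_poly q))" for x q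
  proof -
    have "cinner (toeplitz h x) (ell2_of_poly q)
        = (\<Sum>i\<le>degree q. (\<Sum>j. fourier_coeff h (int i - int j) * coord x j) * cnj (coeff q i))"
      unfolding cinner_def
      by (simp add: coord_toeplitz[OF h], rule suminf_finite) (auto simp: coeff_eq_0)
    also have "\<dots> = (\<Sum>j. \<Sum>i\<le>degree q. fourier_coeff h (int i - int j) * coord x j * cnj (coeff q i))"
      using summable_toeplitz_row[OF h, of _ x]
      by (subst suminf_sum) (auto simp: suminf_mult2 summable_mult2)
    also have "\<dots> = (\<Sum>j. coord x j * cnj (\<Sum>i\<le>degree q. fourier_coeff h (int j - int i) * coeff q i))"
    proof (intro arg_cong[where f=suminf] ext)
      fix j
      have "fourier_coeff h (int i - int j) = cnj (fourier_coeff h (int j - int i))" for i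
        using sym[rule_format, of "int j - int i"] by simp
      then show "(\<Sum>i\<le>degree q. fourier_coeff h (int i - int j) * coord x j * cnj (coeff q i))
          = coord x j * cnj (\<Sum>i\<le>degree q. fourier_coeff h (int j - int i) * coeff q i)"
        by (simp add: sum_distrib_left mult_ac)
    qed
    also have "\<dots> = cinner x (toeplitz h (ell2_of_poly q))"
    proof -
      have "coord (toeplitz h (ell2_of_poly q)) j = (\<Sum>i\<le>degree q. fourier_coeff h (int j - int i) * coeff q i)" for j
        unfolding coord_toeplitz[OF h] by (simp, rule suminf_finite) (auto simp: coeff_eq_0)
      then show ?thesis by (simp add: cinner_def)
    qed
    finally show ?thesis .
  qed
  show "self_adjoint (toeplitz h)"
    unfolding self_adjoint_def
  proof (intro allI)
    fix x y
    have "cinner (toeplitz h x) (diag_proj {..<n} y) = cinner x (toeplitz h (diag_proj {..<n} y))" for n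
      using poly diag_proj_lessThan_poly by metis
    moreover have "(\<lambda>n. cinner x (toeplitz h (diag_proj {..<n} y))) \<longlonglongrightarrow> cinner x (toeplitz h y)"
      by (intro tendsto_cinner_right bounded_linear.tendsto[OF bounded_linear_toeplitz[OF h]]
          diag_proj_lessThan_tendsto)
    moreover have "(\<lambda>n. cinner (toeplitz h x) (diag_proj {..<n} y)) \<longlonglongrightarrow> cinner (toeplitz h x) y"
      by (intro tendsto_cinner_right diag_proj_lessThan_tendsto)
    ultimately show "cinner (toeplitz h x) y = cinner x (toeplitz h y)"
      using LIMSEQ_unique by fastforce
  qed
next
  assume sa: "self_adjoint (toeplitz h)"
  \<comment> \<open>Basis vectors: testing on \<open>e 0\<close> and \<open>e m\<close> compares the
    first column of the matrix with the conjugate of its first row.\<close>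
  define e where "e i = ell2_of_poly (monom 1 i)" for i
  have ce: "coord (e i) j = (if i = j then 1 else 0)" for i j by (simp add: e_def)
  have Te: "coord (toeplitz h (e j)) i = fourier_coeff h (int i - int j)" for i j
    unfolding coord_toeplitz[OF h] by (subst suminf_finite[of "{j}"]) (auto simp: ce)
  have "cinner (toeplitz h (e 0)) (e m) = fourier_coeff h (int m)" for m
    unfolding cinner_def by (subst suminf_finite[of "{m}"]) (auto simp: ce Te)
  moreover have "cinner (e 0) (toeplitz h (e m)) = cnj (fourier_coeff h (- int m))" for m
    unfolding cinner_def by (subst suminf_finite[of "{0}"]) (auto simp: ce Te)
  ultimately have m: "fourier_coeff h (int m) = cnj (fourier_coeff h (- int m))" for m
    using sa unfolding self_adjoint_def by metis
  show "\<forall>n. fourier_coeff h (- n) = cnj (fourier_coeff h n)"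
  proof
    fix n :: int
    show "fourier_coeff h (- n) = cnj (fourier_coeff h n)"
      using m by (cases n rule: int_cases2) (metis complex_cnj_cnj minus_minus)+
  qed
qed

lemma integrable_mult_ess_bdd:
  fixes F G :: "real \<Rightarrow> 'a::{real_normed_field,banach,second_countable_topology}"
  assumes F: "integrable circ F" and G: "ess_bdd G"
  shows "integrable circ (\<lambda>t. F t * G t)"
proof -
  obtain C where C: "AE t in circ. norm (G t) \<le> C"
    using G by (auto simp: ess_bdd_def)
  show ?thesis
  proof (rule Bochner_Integration.integrable_bound)
    show "integrable circ (\<lambda>t. C * norm (F t))"
      using F by simp
    show "(\<lambda>t. F t * G t) \<in> borel_measurable circ"
      using F G by (auto simp: ess_bdd_def intro!: borel_measurable_times)
    show "AE t in circ. norm (F t * G t) \<le> norm (C * norm (F t))"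
      using C
    proof eventually_elim
      case (elim t)
      have "norm (F t) * norm (G t) \<le> norm (F t) * C" by (rule mult_left_mono[OF elim]) simp
      then show ?case using abs_ge_self[of "C * norm (F t)"] by (simp add: norm_mult mult.commute)
    qed
  qed
qed

section \<open>Positivity against squared moduli of analytic polynomials\<close>

text \<open>On the circle \<open>cnj z\<close> is the inverse of \<open>z\<close>, so a polynomial
  in \<open>Re z\<close> and \<open>Im z\<close> becomes analytic after multiplication by a power of
  \<open>z\<close>. That power has modulus one, so the square of the real polynomial equals
  \<open>|q|^2\<close>.\<close>

lemma real_polynomial_function_on_circle:
  fixes p :: "complex \<Rightarrow> real"
  assumes "real_polynomial_function p"
  shows "\<exists>n q. \<forall>z. cmod z = 1 \<longrightarrow> complex_of_real (p z) * z ^ n = poly q z"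
  using assms
proof (induction p rule: real_polynomial_function.induct)
  case (linear f)
  \<comment> \<open>Chosen so that \<open>f z = Re (a * z)\<close>.\<close>
  define a where "a = Complex (f 1) (- f \<i>)"
  have f: "complex_of_real (f z) = (a * z + cnj a * cnj z) / 2" for z
  proof -
    have "f z = f (Re z *\<^sub>R 1 + Im z *\<^sub>R \<i>)"
      by (intro arg_cong[where f=f]) (simp add: complex_eq_iff)
    also have "\<dots> = Re z * f 1 + Im z * f \<i>"
      using bounded_linear.linear[OF linear] by (simp only: linear_add linear_scale real_scaleR_def)
    finally have "f z = Re z * f 1 + Im z * f \<i>" .
    then show ?thesis by (simp add: a_def complex_eq_iff)
  qed
  show ?case
  proof (rule exI[of _ 1], rule exI[of _ "[:cnj a / 2, 0, a / 2:]"], intro allI impI)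
    fix z :: complex assume "cmod z = 1"
    then have "z * cnj z = 1" by (metis complex_norm_square of_real_1 power_one)
    then show "complex_of_real (f z) * z ^ 1 = poly [:cnj a / 2, 0, a / 2:] z"
      unfolding f by (simp add: algebra_simps add_divide_distrib[symmetric])
  qed
next
  case (const c)
  show ?case by (rule exI[of _ 0], rule exI[of _ "[:complex_of_real c:]"]) simp
next
  case (add f g)
  then obtain n q m r where
    "\<And>z. cmod z = 1 \<Longrightarrow> complex_of_real (f z) * z ^ n = poly q z"
    "\<And>z. cmod z = 1 \<Longrightarrow> complex_of_real (g z) * z ^ m = poly r z" by blast
  then have "\<forall>z. cmod z = 1 \<longrightarrow> complex_of_real (f z + g z) * z ^ (n + m) = poly (q * monom 1 m + r * monom 1 n) z"
    by (simp add: poly_monom power_add distrib_right flip: mult.assoc)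
  then show ?case by blast
next
  case (mult f g)
  then obtain n q m r where qr:
    "\<And>z. cmod z = 1 \<Longrightarrow> complex_of_real (f z) * z ^ n = poly q z"
    "\<And>z. cmod z = 1 \<Longrightarrow> complex_of_real (g z) * z ^ m = poly r z" by blast
  have "complex_of_real (f z * g z) * z ^ (n + m) = poly (q * r) z" if "cmod z = 1" for z
    unfolding poly_mult qr[OF that, symmetric] by (simp add: power_add)
  then show ?case by blast
qed

text \<open>Functions of the form \<open>|q|^2\<close> converge boundedly and almost everywhere to
  the indicator of the set \<open>S\<close> where \<open>F\<close> is negative. The integral of
  \<open>F\<close> over \<open>S\<close> is therefore nonnegative, which forces \<open>S\<close> to
  be null.\<close>

lemma AE_nonneg_of_integral_poly:
  fixes F :: "real \<Rightarrow> real"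
  assumes F: "integrable circ F"
    and pos: "\<And>q. 0 \<le> (LINT t|circ. F t * (cmod (poly q (cis t)))\<^sup>2)"
  shows "AE t in circ. 0 \<le> F t"
proof -
  have Fm [measurable]: "F \<in> borel_measurable circ" using F by simp
  define S where "S = {t \<in> space circ. F t < 0}"
  have Sc: "S \<in> sets circ" unfolding S_def by measurable
  then have "S \<in> sets lebesgue" by (auto simp: sets_restrict_space_iff)
  then have "(indicat_real S) measurable_on UNIV"
    by (intro lebesgue_measurable_imp_measurable_on_real) auto
  then obtain N g where N: "negligible N" and g: "\<And>n. continuous_on UNIV (g n)"
    and lim: "\<And>t. t \<notin> N \<Longrightarrow> (\<lambda>n. g n t) \<longlonglongrightarrow> indicat_real S t"
    unfolding measurable_on_def by auto
  \<comment> \<open>Clipping to \<open>[0,1]\<close> keeps the limit, since an indicator takes only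
    the values 0 and 1, and supplies the bound for dominated convergence.\<close>
  define c where "c n t = max 0 (min 1 (g n t))" for n t
  have c01: "0 \<le> c n t" "c n t \<le> 1" for n t by (auto simp: c_def)
  have cc: "continuous_on UNIV (c n)" for n
    unfolding c_def using g by (intro continuous_intros)
  \<comment> \<open>\<open>Arg2pi\<close> jumps at 1; the second factor vanishes there, which
    restores continuity on the circle, and it tends to 1 at every other point.\<close>
  define \<psi> where "\<psi> n z = c n (Arg2pi z) * min 1 (real n * cmod (z - 1))" for n z
  have \<psi>01: "0 \<le> \<psi> n z" "\<psi> n z \<le> 1" for n z
    using c01[of n "Arg2pi z"] by (auto simp: \<psi>_def intro!: mult_le_one)
  have cont: "continuous_on (sphere 0 1) (\<psi> n)" for n
    unfolding continuous_on_eq_continuous_within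
  proof
    fix z :: complex assume z: "z \<in> sphere 0 1"
    show "continuous (at z within sphere 0 1) (\<psi> n)"
    proof (cases "z = 1")
      case True
      have "(\<psi> n \<longlongrightarrow> 0) (at 1 within sphere 0 1)"
      proof (rule Lim_null_comparison)
        show "\<forall>\<^sub>F z in at 1 within sphere 0 1. norm (\<psi> n z) \<le> real n * cmod (z - 1)"
        proof (intro always_eventually allI)
          fix z
          have "\<psi> n z \<le> 1 * min 1 (real n * cmod (z - 1))"
            unfolding \<psi>_def by (intro mult_right_mono c01) auto
          then show "norm (\<psi> n z) \<le> real n * cmod (z - 1)" using \<psi>01(1)[of n z] by simp
        qed
        show "((\<lambda>z. real n * cmod (z - 1)) \<longlongrightarrow> 0) (at 1 within sphere 0 1)"
          by (auto intro!: tendsto_eq_intros)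
      qed
      moreover have "\<psi> n 1 = 0" by (simp add: \<psi>_def)
      ultimately show ?thesis using True by (simp add: continuous_within)
    next
      case False
      have "z \<notin> \<real>\<^sub>\<ge>\<^sub>0"
      proof
        assume "z \<in> \<real>\<^sub>\<ge>\<^sub>0"
        then obtain r where "z = of_real r" "0 \<le> r" by (auto simp: nonneg_Reals_def)
        then show False using z False by simp
      qed
      then have "continuous (at z) Arg2pi" by (rule continuous_at_Arg2pi)
      moreover have "isCont (c n) (Arg2pi z)"
        using cc continuous_on_eq_continuous_at by blast
      ultimately have "continuous (at z) (\<lambda>z. c n (Arg2pi z))"
        using isCont_o2 by blast
      then have "continuous (at z) (\<psi> n)"
        unfolding \<psi>_def by (intro continuous_intros)
      then show ?thesis by (rule continuous_at_imp_continuous_at_within)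
    qed
  qed
  have "\<exists>p. real_polynomial_function p \<and> (\<forall>z\<in>sphere 0 1. \<bar>\<psi> n z - p z\<bar> < 1 / real (Suc n))" for n
    using Stone_Weierstrass_real_polynomial_function[OF compact_sphere cont, of "1 / real (Suc n)" n]
    by (metis zero_less_divide_1_iff of_nat_0_less_iff zero_less_Suc)
  then obtain p where p: "\<And>n. real_polynomial_function (p n)"
    and pd: "\<And>n z. z \<in> sphere 0 1 \<Longrightarrow> \<bar>\<psi> n z - p n z\<bar> < 1 / real (Suc n)"
    by metis
  have pb: "(p n (cis t))\<^sup>2 \<le> 4" for n t
  proof -
    have circ: "cis t \<in> sphere 0 1" by simp
    have "1 / real (Suc n) \<le> 1" by simp
    then have "\<bar>p n (cis t)\<bar> \<le> 2"
      using pd[OF circ, of n] \<psi>01[of n "cis t"] by linarith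
    then have "\<bar>p n (cis t)\<bar>\<^sup>2 \<le> 2\<^sup>2" by (intro power_mono) auto
    then show ?thesis by simp
  qed
  have p2: "\<exists>q. \<forall>t. (p n (cis t))\<^sup>2 = (cmod (poly q (cis t)))\<^sup>2" for n
  proof -
    obtain k q where q: "\<And>z. cmod z = 1 \<Longrightarrow> complex_of_real (p n z) * z ^ k = poly q z"
      using real_polynomial_function_on_circle[OF p] by blast
    have "(p n (cis t))\<^sup>2 = (cmod (poly q (cis t)))\<^sup>2" for t
      using q[of "cis t", symmetric] by (simp add: norm_mult norm_power)
    then show ?thesis by blast
  qed
  have ptend: "(\<lambda>n. p n (cis t)) \<longlonglongrightarrow> indicat_real S t" if t: "0 < t" "t < 2 * pi" "t \<notin> N" for t
  proof -
    have Arg: "Arg2pi (cis t) = t"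
      using t by (intro Arg2pi_unique[of 1]) (auto simp: cis_conv_exp)
    have ne: "cis t \<noteq> 1"
      using Arg t Arg2pi_of_real[of 1] by auto
    have "(\<lambda>n. c n t) \<longlonglongrightarrow> max 0 (min 1 (indicat_real S t))"
      unfolding c_def by (intro tendsto_intros lim t)
    then have c: "(\<lambda>n. c n t) \<longlonglongrightarrow> indicat_real S t" by (simp add: indicator_def split: if_splits)
    have "\<forall>\<^sub>F n in sequentially. min 1 (real n * cmod (cis t - 1)) = 1"
    proof -
      obtain n0 where "1 < real n0 * cmod (cis t - 1)"
        using ne reals_Archimedean3[of "cmod (cis t - 1)"] by auto
      moreover have "real n0 * cmod (cis t - 1) \<le> real n * cmod (cis t - 1)" if "n0 \<le> n" for n
        using that by (intro mult_right_mono) auto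
      ultimately show ?thesis
        unfolding eventually_sequentially by (intro exI[of _ n0]) (auto simp: min_def intro: order_trans less_imp_le)
    qed
    then have m: "(\<lambda>n. min 1 (real n * cmod (cis t - 1))) \<longlonglongrightarrow> 1"
      by (rule tendsto_eventually)
    have \<psi>: "(\<lambda>n. \<psi> n (cis t)) \<longlonglongrightarrow> indicat_real S t"
      unfolding \<psi>_def Arg using tendsto_mult[OF c m] by simp
    have "(\<lambda>n. p n (cis t) - \<psi> n (cis t)) \<longlonglongrightarrow> 0"
    proof (rule Lim_null_comparison)
      show "\<forall>\<^sub>F n in sequentially. norm (p n (cis t) - \<psi> n (cis t)) \<le> 1 / real (Suc n)"
        using pd[of "cis t"] by (intro always_eventually allI) (simp add: abs_minus_commute less_imp_le)
      show "(\<lambda>n. 1 / real (Suc n)) \<longlonglongrightarrow> 0"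
        using LIMSEQ_inverse_real_of_nat by (simp add: inverse_eq_divide)
    qed
    from tendsto_add[OF this \<psi>] show ?thesis by simp
  qed
  \<comment> \<open>The endpoints are discarded because both are mapped to 1, where the cut-off
    factor is 0.\<close>
  have "AE t in circ. t \<notin> N \<union> {0, 2*pi}"
  proof -
    have "negligible (N \<union> {0, 2*pi})" using N by simp
    then have "AE t in lebesgue. t \<notin> N \<union> {0, 2*pi}"
      by (intro AE_not_in) (simp only: negligible_iff_null_sets)
    then show ?thesis by (auto simp: AE_restrict_space_iff elim: eventually_mono)
  qed
  then have AEt: "AE t in circ. (\<lambda>n. p n (cis t)) \<longlonglongrightarrow> indicat_real S t"
    by (rule AE_mp, intro AE_I2) (auto intro!: ptend simp: less_le)
  have pm: "(\<lambda>t. (p n (cis t))\<^sup>2) \<in> borel_measurable circ" for n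
  proof -
    obtain q where "\<And>t. (p n (cis t))\<^sup>2 = (cmod (poly q (cis t)))\<^sup>2" using p2 by blast
    then show ?thesis by (simp add: ess_bdd_measurable ess_bdd_cmod ess_bdd_power2)
  qed
  have "(\<lambda>n. LINT t|circ. F t * (p n (cis t))\<^sup>2) \<longlonglongrightarrow> (LINT t|circ. F t * (indicat_real S t)\<^sup>2)"
  proof (rule integral_dominated_convergence)
    show "integrable circ (\<lambda>t. 4 * \<bar>F t\<bar>)" using F by simp
    show "AE t in circ. (\<lambda>n. F t * (p n (cis t))\<^sup>2) \<longlonglongrightarrow> F t * (indicat_real S t)\<^sup>2"
      using AEt by eventually_elim (intro tendsto_intros)
    show "AE t in circ. norm (F t * (p n (cis t))\<^sup>2) \<le> 4 * \<bar>F t\<bar>" for n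
      using pb by (intro AE_I2) (simp add: abs_mult mult.commute mult_left_mono)
  qed (use pm Sc in \<open>auto intro!: borel_measurable_times borel_measurable_power\<close>)
  moreover have "0 \<le> (LINT t|circ. F t * (p n (cis t))\<^sup>2)" for n
  proof -
    obtain q where "\<And>t. (p n (cis t))\<^sup>2 = (cmod (poly q (cis t)))\<^sup>2" using p2 by blast
    then show ?thesis using pos[of q] by simp
  qed
  ultimately have "0 \<le> (LINT t|circ. F t * (indicat_real S t)\<^sup>2)"
    by (intro LIMSEQ_le_const) auto
  also have "(\<lambda>t. F t * (indicat_real S t)\<^sup>2) = (\<lambda>t. F t * indicat_real S t)"
    by (auto simp: indicator_def)
  finally have ge: "0 \<le> (LINT t|circ. F t * indicat_real S t)" .
  have int: "integrable circ (\<lambda>t. F t * indicat_real S t)"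
    using Sc F integrable_mult_indicator[OF Sc F] by (simp add: mult.commute)
  have np: "F t * indicat_real S t \<le> 0" for t
    by (auto simp: indicator_def S_def)
  have "(LINT t|circ. - (F t * indicat_real S t)) = 0"
  proof (rule antisym)
    show "0 \<le> (LINT t|circ. - (F t * indicat_real S t))"
      using np by (intro integral_nonneg_AE) auto
  qed (use ge in simp)
  then have "AE t in circ. - (F t * indicat_real S t) = 0"
    using int np by (subst (asm) integral_nonneg_eq_0_iff_AE) auto
  then show ?thesis
    by (rule AE_mp, intro AE_I2) (auto simp: S_def indicator_def split: if_splits)
qed

section \<open>Analytic factorization of a weight\<close>

text \<open>The Riesz-Fischer argument with an integrable majorant: the geometric decay makes the
  weighted increments \<open>d n\<close> summable almost everywhere, and their sum controls both the
  convergence and the size of \<open>u n\<close>.\<close>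

lemma L2_Cauchy_convergent_AE:
  fixes u :: "nat \<Rightarrow> real \<Rightarrow> complex"
  assumes u: "\<And>n. ess_bdd (u n)"
    and fast: "\<And>n. (LINT t|circ. (cmod (u (Suc n) t - u n t))\<^sup>2) \<le> K * (1/4) ^ n"
  shows "\<exists>G. integrable circ G \<and> (AE t in circ. convergent (\<lambda>n. u n t) \<and> (\<forall>n. (cmod (u n t))\<^sup>2 \<le> G t))"
proof -
  \<comment> \<open>The weight \<open>2 ^ n\<close> spends half of the decay rate: the integrals
    remain summable, and the gain yields summability of the unsquared increments.\<close>
  define d where "d n t = 2 ^ n * (cmod (u (Suc n) t - u n t))\<^sup>2" for n t
  have d0: "0 \<le> d n t" for n t by (simp add: d_def)
  have db: "ess_bdd (d n)" for n
    unfolding d_def using u by auto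
  have [measurable]: "d n \<in> borel_measurable circ" for n
    by (rule ess_bdd_measurable[OF db])
  have dint: "integrable circ (d n)" for n
    by (rule ess_bdd_integrable[OF db])
  have di: "(LINT t|circ. d n t) \<le> K * (1/2) ^ n" for n
  proof -
    have "(LINT t|circ. d n t) \<le> 2 ^ n * (K * (1/4) ^ n)"
      unfolding d_def using fast[of n] by simp
    also have "\<dots> = K * (1/2) ^ n"
      by (simp add: power_mult_distrib[symmetric] mult.left_commute)
    finally show ?thesis .
  qed
  have sdi: "summable (\<lambda>n. LINT t|circ. d n t)"
  proof (rule summable_comparison_test')
    show "summable (\<lambda>n. K * (1/2) ^ n)" by (intro summable_mult summable_geometric) simp
    show "norm (LINT t|circ. d n t) \<le> K * (1/2) ^ n" for n
      using di d0 by (simp add: integral_nonneg_AE)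
  qed
  have AEs: "AE t in circ. summable (\<lambda>n. d n t)"
  proof -
    have "(\<integral>\<^sup>+t. (\<Sum>n. ennreal (d n t)) \<partial>circ) = (\<Sum>n. \<integral>\<^sup>+t. ennreal (d n t) \<partial>circ)"
      by (intro nn_integral_suminf) measurable
    also have "\<dots> = (\<Sum>n. ennreal (LINT t|circ. d n t))"
      using dint d0 by (subst nn_integral_eq_integral) auto
    also have "\<dots> = ennreal (\<Sum>n. LINT t|circ. d n t)"
      using d0 sdi by (intro suminf_ennreal2) (auto intro: integral_nonneg_AE)
    finally have "(\<integral>\<^sup>+t. (\<Sum>n. ennreal (d n t)) \<partial>circ) \<noteq> \<infinity>" by simp
    then have "AE t in circ. (\<Sum>n. ennreal (d n t)) \<noteq> \<infinity>"
      by (intro nn_integral_PInf_AE) measurable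
    then show ?thesis
      by eventually_elim (auto intro!: summable_suminf_not_top d0)
  qed
  define G where "G t = 2 * (cmod (u 0 t))\<^sup>2 + 4 * (\<Sum>n. d n t)" for t
  have "integrable circ (\<lambda>t. \<Sum>n. d n t)"
    using dint AEs sdi d0 by (intro integrable_suminf) auto
  then have "integrable circ G"
    unfolding G_def using u[of 0]
    by (intro Bochner_Integration.integrable_add integrable_mult_right) (auto intro!: ess_bdd_integrable)
  moreover have "AE t in circ. convergent (\<lambda>n. u n t) \<and> (\<forall>n. (cmod (u n t))\<^sup>2 \<le> G t)"
    using AEs
  proof eventually_elim
    case (elim t)
    define \<Delta> where "\<Delta> n = u (Suc n) t - u n t" for n
    have tele: "u n t = u 0 t + (\<Sum>k<n. \<Delta> k)" for n
      unfolding \<Delta>_def using sum_lessThan_telescope[of "\<lambda>n. u n t" n] by simp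
    have "summable \<Delta>"
    proof (rule summable_comparison_test')
      show "summable (\<lambda>n. (1/2) ^ n + d n t)"
        by (intro summable_add summable_geometric elim) simp
      \<comment> \<open>Comes from expanding
        \<open>2^n * (2^(-n) - |\<Delta> n|)^2 \<ge> 0\<close>.\<close>
      show "norm (\<Delta> n) \<le> (1/2) ^ n + d n t" for n
      proof -
        have "(1/2::real) ^ n * 2 ^ n = 1" by (simp flip: power_mult_distrib)
        moreover have "2 ^ n * (h - c)\<^sup>2 = h * (h * 2 ^ n) - 2 * c * (h * 2 ^ n) + 2 ^ n * c\<^sup>2" for h c :: real
          by (simp add: power2_eq_square algebra_simps)
        ultimately have "2 ^ n * ((1/2) ^ n - cmod (\<Delta> n))\<^sup>2 = (1/2) ^ n - 2 * cmod (\<Delta> n) + d n t"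
          by (simp only: mult_1_right d_def \<Delta>_def)
        moreover have "0 \<le> 2 ^ n * ((1/2) ^ n - cmod (\<Delta> n))\<^sup>2" by simp
        ultimately have "2 * cmod (\<Delta> n) \<le> (1/2) ^ n + d n t" by linarith
        moreover have "0 \<le> (1/2) ^ n + d n t" using d0 by simp
        ultimately show ?thesis by (smt (verit) norm_ge_zero)
      qed
    qed
    then have "(\<lambda>n. u 0 t + (\<Sum>k<n. \<Delta> k)) \<longlonglongrightarrow> u 0 t + suminf \<Delta>"
      by (intro tendsto_intros summable_LIMSEQ)
    then have "convergent (\<lambda>n. u n t)"
      unfolding tele[symmetric] by (auto simp: convergent_def)
    moreover have "(cmod (u n t))\<^sup>2 \<le> G t" for n
    proof -
      have "(cmod (\<Sum>k<n. \<Delta> k))\<^sup>2 \<le> (\<Sum>k<n. cmod (\<Delta> k))\<^sup>2"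
        by (intro power_mono norm_sum) auto
      \<comment> \<open>Inserting \<open>(1 / sqrt 2) ^ k * sqrt 2 ^ k = 1\<close> prepares
        Cauchy-Schwarz: one resulting sum is geometric, at most 2, and the other is a partial sum of
        \<open>d k t\<close>.\<close>
      also have "\<dots> = (\<Sum>k<n. ((1 / sqrt 2) ^ k) * (sqrt 2 ^ k * cmod (\<Delta> k)))\<^sup>2"
        by (simp add: mult.assoc[symmetric] power_mult_distrib[symmetric])
      also have "\<dots> \<le> (\<Sum>k<n. ((1 / sqrt 2) ^ k)\<^sup>2) * (\<Sum>k<n. (sqrt 2 ^ k * cmod (\<Delta> k))\<^sup>2)"
        by (rule Cauchy_Schwarz_ineq_sum)
      also have "\<dots> = (\<Sum>k<n. (1/2) ^ k) * (\<Sum>k<n. d k t)"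
      proof -
        have "((1 / sqrt 2) ^ k)\<^sup>2 = (1/2) ^ k" "(sqrt 2 ^ k)\<^sup>2 = 2 ^ k" for k
          by (simp_all add: power_divide flip: real_sqrt_power)
        then show ?thesis by (simp add: power_mult_distrib d_def \<Delta>_def)
      qed
      also have "\<dots> \<le> 2 * (\<Sum>k. d k t)"
      proof (intro mult_mono)
        show "(\<Sum>k<n. (1/2::real) ^ k) \<le> 2"
          using sum_le_suminf[of "\<lambda>k. (1/2::real) ^ k" "{..<n}"] by (simp add: suminf_geometric)
        show "(\<Sum>k<n. d k t) \<le> (\<Sum>k. d k t)"
          by (intro sum_le_suminf elim) (auto simp: d0)
      qed (auto intro!: sum_nonneg d0)
      finally have "(cmod (\<Sum>k<n. \<Delta> k))\<^sup>2 \<le> 2 * (\<Sum>k. d k t)" .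
      moreover have "(cmod (u n t))\<^sup>2 \<le> 2 * (cmod (u 0 t))\<^sup>2 + 2 * (cmod (\<Sum>k<n. \<Delta> k))\<^sup>2"
      proof -
        have "(cmod (u n t))\<^sup>2 \<le> (cmod (u 0 t) + cmod (\<Sum>k<n. \<Delta> k))\<^sup>2"
          unfolding tele[of n] by (intro power_mono norm_triangle_ineq) auto
        then show ?thesis
          using sum_squares_bound[of "cmod (u 0 t)" "cmod (\<Sum>k<n. \<Delta> k)"] by (simp add: power2_sum)
      qed
      ultimately show ?thesis by (simp add: G_def)
    qed
    ultimately show ?case by blast
  qed
  ultimately show ?thesis by blast
qed

text \<open>On the circle \<open>|q|^2\<close> is a finite combination of characters, each of which
  integrates to zero against \<open>F\<close>.\<close>

lemma integral_mult_cmod_poly_power2_eq_0: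
  fixes F :: "real \<Rightarrow> real"
  assumes F: "integrable circ F" and 0: "\<And>n::int. (LINT t|circ. F t * cis (of_int n * t)) = 0"
  shows "(LINT t|circ. F t * (cmod (poly q (cis t)))\<^sup>2) = 0"
proof -
  let ?d = "degree q"
  have iFc: "integrable circ (\<lambda>t. F t * cis (of_int n * t))" for n
    using F by (intro integrable_mult_ess_bdd) (auto simp: complex_of_real_integrable_eq)
  have "complex_of_real (F t * (cmod (poly q (cis t)))\<^sup>2)
      = (\<Sum>i\<le>?d. \<Sum>j\<le>?d. coeff q i * cnj (coeff q j) * (F t * cis (of_int (int i - int j) * t)))" for t
  proof -
    have c: "cis t ^ i * cnj (cis t ^ j) = cis (of_int (int i - int j) * t)" for i j
      unfolding cis_power_int by (simp add: cis_cnj cis_mult algebra_simps)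
    have "complex_of_real ((cmod (poly q (cis t)))\<^sup>2)
        = (\<Sum>i\<le>?d. \<Sum>j\<le>?d. (coeff q i * cis t ^ i) * cnj (coeff q j * cis t ^ j))"
      unfolding complex_norm_square unfolding poly_altdef by (simp add: sum_product)
    also have "\<dots> = (\<Sum>i\<le>?d. \<Sum>j\<le>?d. coeff q i * cnj (coeff q j) * cis (of_int (int i - int j) * t))"
      unfolding c[symmetric] by (simp add: mult_ac)
    finally show ?thesis
      by (simp add: sum_distrib_left mult_ac del: of_real_power)
  qed
  then have "complex_of_real (LINT t|circ. F t * (cmod (poly q (cis t)))\<^sup>2)
      = (LINT t|circ. (\<Sum>i\<le>?d. \<Sum>j\<le>?d. coeff q i * cnj (coeff q j) * (F t * cis (of_int (int i - int j) * t))))"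
    by (simp only: flip: integral_complex_of_real)
  also have "\<dots> = (\<Sum>i\<le>?d. \<Sum>j\<le>?d. LINT t|circ. coeff q i * cnj (coeff q j) * (F t * cis (of_int (int i - int j) * t)))"
    using iFc
    by (subst Bochner_Integration.integral_sum,
        intro Bochner_Integration.integrable_sum integrable_mult_right,
        blast intro: integrable_mult_right)
       (intro sum.cong refl Bochner_Integration.integral_sum integrable_mult_right iFc)
  also have "\<dots> = 0"
    by (simp only: integral_mult_right_zero 0 mult_zero_right sum.neutral_const)
  finally show ?thesis by simp
qed

text \<open>Both \<open>W - D\<close> and \<open>D - W\<close> integrate to zero against every
  \<open>|q|^2\<close>, so the positivity test applies to each. The negative frequencies follow by
  conjugation because \<open>W\<close> is real.\<close>

lemma AE_eq_const_of_fourier: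
  fixes W :: "real \<Rightarrow> real"
  assumes W: "integrable circ W"
    and 0: "\<And>k::nat. 0 < k \<Longrightarrow> (LINT t|circ. W t * cis (of_nat k * t)) = 0"
    and D: "(LINT t|circ. W t) = 2 * pi * D"
  shows "AE t in circ. W t = D"
proof -
  have iW: "integrable circ (\<lambda>t. W t * cis (of_int n * t))" for n
    using W by (intro integrable_mult_ess_bdd) (auto simp: complex_of_real_integrable_eq)
  have W0: "(LINT t|circ. W t * cis (of_int n * t)) = 0" if "n \<noteq> 0" for n :: int
  proof (cases "0 < n")
    case True
    then show ?thesis using 0[of "nat n"] by simp
  next
    case False
    then have "cnj (LINT t|circ. W t * cis (of_int n * t)) = (LINT t|circ. W t * cis (of_nat (nat (- n)) * t))"
      by (subst Bochner_Integration.integral_cnj[symmetric]) (simp add: cis_cnj)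
    also have "\<dots> = 0" using 0[of "nat (- n)"] that False by simp
    finally show ?thesis by simp
  qed
  have F0: "(LINT t|circ. complex_of_real (W t - D) * cis (of_int n * t)) = 0" for n :: int
  proof -
    have "(LINT t|circ. complex_of_real (W t - D) * cis (of_int n * t))
        = (LINT t|circ. W t * cis (of_int n * t)) - (LINT t|circ. D * cis (of_int n * t))"
      unfolding of_real_diff left_diff_distrib
      using iW by (intro Bochner_Integration.integral_diff) (auto intro!: ess_bdd_integrable)
    also have "\<dots> = 0"
      unfolding integral_mult_right_zero integral_circ_cis using W0[of n] D by (cases "n = 0") simp_all
    finally show ?thesis .
  qed
  have iF: "integrable circ (\<lambda>t. W t - D)" "integrable circ (\<lambda>t. D - W t)"
    using W by auto
  have "AE t in circ. 0 \<le> W t - D"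
    using integral_mult_cmod_poly_power2_eq_0[OF iF(1) F0]
    by (intro AE_nonneg_of_integral_poly iF) simp
  moreover have "AE t in circ. 0 \<le> D - W t"
  proof (intro AE_nonneg_of_integral_poly iF)
    fix q
    have "(LINT t|circ. (D - W t) * (cmod (poly q (cis t)))\<^sup>2) = - (LINT t|circ. (W t - D) * (cmod (poly q (cis t)))\<^sup>2)"
      by (subst integral_minus[symmetric]) (simp add: algebra_simps)
    then show "0 \<le> (LINT t|circ. (D - W t) * (cmod (poly q (cis t)))\<^sup>2)"
      using integral_mult_cmod_poly_power2_eq_0[OF iF(1) F0] by simp
  qed
  ultimately show ?thesis by eventually_elim simp
qed

text \<open>Szego's extremal problem: \<open>\<phi>\<close> minimizes the mean of \<open>|q|\<^sup>2 v\<close> over analytic \<open>q\<close> with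
  \<open>q(0) = 1\<close>. Comparing \<open>\<phi>\<close> with \<open>\<phi> (1 + \<alpha> z\<^sup>k)\<close> shows that \<open>|\<phi>|\<^sup>2 v\<close> has no nonconstant Fourier
  coefficients, and comparing with \<open>q = 1\<close> bounds the minimum.\<close>

lemma szego_factorization:
  fixes v :: "real \<Rightarrow> real"
  assumes vm: "v \<in> borel_measurable circ" and m: "0 < m"
    and vge: "AE t in circ. m \<le> v t" and vle: "AE t in circ. v t \<le> B"
  shows "\<exists>\<phi>\<in>Linf_circle. \<exists>D>0. D \<le> 1 / (2*pi) * (LINT t|circ. v t) \<and>
    (AE t in circ. (cmod (\<phi> (cis t)))\<^sup>2 * v t = D) \<and>
    (\<forall>n<0. fourier_coeff \<phi> n = 0) \<and> fourier_coeff \<phi> 0 = 1"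
proof -
  have v: "ess_bdd v"
  proof (rule ess_bddI[OF vm])
    show "AE t in circ. norm (v t) \<le> B" using vge vle by eventually_elim (use m in auto)
  qed
  define I where "I q = (LINT t|circ. (cmod (poly q (cis t)))\<^sup>2 * v t)" for q
  have bI: "ess_bdd (\<lambda>t. (cmod (poly q (cis t)))\<^sup>2 * v t)" for q
    using v by auto
  have I0: "0 \<le> I q" for q
    unfolding I_def by (rule integral_nonneg_AE) (use vge m in \<open>auto elim!: eventually_mono\<close>)
  define D' where "D' = Inf {I q |q. poly q 0 = 1}"
  have ne: "{I q |q. poly q 0 = 1} \<noteq> {}" by (auto intro!: exI[of _ 1])
  have bdd: "bdd_below {I q |q. poly q 0 = 1}" by (rule bdd_belowI[of _ 0]) (auto simp: I0)
  have D'le: "D' \<le> I q" if "poly q 0 = 1" for q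
    unfolding D'_def by (rule cInf_lower[OF _ bdd]) (use that in auto)
  have D'0: "0 \<le> D'" unfolding D'_def by (rule cInf_greatest[OF ne]) (auto simp: I0)
  \<comment> \<open>The minimizing sequence is chosen with geometric excess, which the parallelogram
    law converts into geometric \<open>L^2\<close> convergence.\<close>
  have "\<exists>q. poly q 0 = 1 \<and> I q < D' + (1/4) ^ n" for n
    using cInf_lessD[OF ne, of "D' + (1/4) ^ n"] unfolding D'_def[symmetric] by auto
  then obtain p where p0: "\<And>n. poly (p n) 0 = 1" and pI: "\<And>n. I (p n) < D' + (1/4) ^ n"
    by metis
  \<comment> \<open>Parallelogram law for the weighted norm. The midpoint of two admissible
    polynomials is admissible, so its value is at least \<open>D'\<close>, and near-minimizers must
    be close to each other.\<close>
  have par: "I (q - r) = 2 * I q + 2 * I r - 4 * I (smult (1/2) (q + r))" for q r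
  proof -
    have "(cmod (a - b))\<^sup>2 * w = 2 * ((cmod a)\<^sup>2 * w) + 2 * ((cmod b)\<^sup>2 * w) - 4 * ((cmod ((1/2) * (a + b)))\<^sup>2 * w)"
      for a b w
      unfolding norm_mult power_mult_distrib cmod_power2
      by (simp add: power2_eq_square algebra_simps)
    then have "I (q - r) = (LINT t|circ. 2 * ((cmod (poly q (cis t)))\<^sup>2 * v t) + 2 * ((cmod (poly r (cis t)))\<^sup>2 * v t)
        - 4 * ((cmod (poly (smult (1/2) (q + r)) (cis t)))\<^sup>2 * v t))"
      unfolding I_def poly_diff poly_smult poly_add by (simp only:)
    also have "\<dots> = 2 * I q + 2 * I r - 4 * I (smult (1/2) (q + r))"
      unfolding I_def
      by (subst Bochner_Integration.integral_diff Bochner_Integration.integral_add,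
          (intro Bochner_Integration.integrable_add integrable_mult_right ess_bdd_integrable bI)+)+
         (simp only: integral_mult_right_zero)
    finally show ?thesis .
  qed
  \<comment> \<open>The two excesses contribute at most \<open>4 * (1/4) ^ n\<close>; division by
    \<open>m\<close> passes from the weighted integral to the plain one.\<close>
  have fast: "(LINT t|circ. (cmod (poly (p (Suc n)) (cis t) - poly (p n) (cis t)))\<^sup>2) \<le> (4 / m) * (1/4) ^ n" for n
  proof -
    have "D' \<le> I (smult (1/2) (p (Suc n) + p n))" by (rule D'le) (simp add: p0)
    moreover have "(1/4::real) ^ Suc n \<le> (1/4) ^ n" by simp
    ultimately have le: "I (p (Suc n) - p n) \<le> 4 * (1/4) ^ n"
      using par[of "p (Suc n)" "p n"] pI[of n] pI[of "Suc n"] by linarith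
    have "m * (LINT t|circ. (cmod (poly (p (Suc n) - p n) (cis t)))\<^sup>2)
        = (LINT t|circ. (cmod (poly (p (Suc n) - p n) (cis t)))\<^sup>2 * m)"
      by (simp add: mult.commute)
    also have "\<dots> \<le> I (p (Suc n) - p n)"
      unfolding I_def
    proof (rule integral_mono_AE)
      show "AE t in circ. (cmod (poly (p (Suc n) - p n) (cis t)))\<^sup>2 * m \<le> (cmod (poly (p (Suc n) - p n) (cis t)))\<^sup>2 * v t"
        using vge by eventually_elim (rule mult_left_mono, auto)
    qed (intro ess_bdd_integrable bI ess_bdd_mult ess_bdd_const ess_bdd_power2 ess_bdd_cmod ess_bdd_poly)+
    finally have "m * (LINT t|circ. (cmod (poly (p (Suc n) - p n) (cis t)))\<^sup>2) \<le> 4 * (1/4) ^ n"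
      using le by linarith
    then have "(LINT t|circ. (cmod (poly (p (Suc n) - p n) (cis t)))\<^sup>2) \<le> (4 * (1/4) ^ n) / m"
      unfolding pos_le_divide_eq[OF m] by (simp only: mult.commute)
    then show ?thesis by simp
  qed
  obtain G where G: "integrable circ G"
    and AG: "AE t in circ. convergent (\<lambda>n. poly (p n) (cis t)) \<and> (\<forall>n. (cmod (poly (p n) (cis t)))\<^sup>2 \<le> G t)"
    using L2_Cauchy_convergent_AE[OF _ fast] by auto
  \<comment> \<open>\<open>lim\<close> is an unspecified value where the sequence diverges, which on
    the circle happens only on a null set.\<close>
  define \<phi> where "\<phi> z = lim (\<lambda>n. poly (p n) z)" for z
  have pm [measurable]: "(\<lambda>t. poly q (cis t)) \<in> borel_measurable circ" for q
    by (rule ess_bdd_measurable[OF ess_bdd_poly])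
  have \<phi>m [measurable]: "(\<lambda>t. \<phi> (cis t)) \<in> borel_measurable circ"
    unfolding \<phi>_def by measurable
  have lim: "AE t in circ. (\<lambda>n. poly (p n) (cis t)) \<longlonglongrightarrow> \<phi> (cis t)"
    using AG by eventually_elim (simp add: \<phi>_def convergent_LIMSEQ_iff)
  note [measurable] = vm
  have cis_m [measurable]: "(\<lambda>t. cis (c * t)) \<in> borel_measurable circ" for c
    by (rule ess_bdd_measurable) simp
  \<comment> \<open>The extra factor \<open>s\<close> brings in the competitors
    \<open>p n * s\<close>, which are admissible when \<open>s\<close> has value 1 at 0.\<close>
  have Ilim: "(\<lambda>n. I (p n * s)) \<longlonglongrightarrow> (LINT t|circ. (cmod (\<phi> (cis t)))\<^sup>2 * v t * (cmod (poly s (cis t)))\<^sup>2)"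
    and Iint: "integrable circ (\<lambda>t. (cmod (\<phi> (cis t)))\<^sup>2 * v t * (cmod (poly s (cis t)))\<^sup>2)" for s
  proof -
    have "ess_bdd (\<lambda>t. v t * (cmod (poly s (cis t)))\<^sup>2)" using v by auto
    then have w: "integrable circ (\<lambda>t. G t * (v t * (cmod (poly s (cis t)))\<^sup>2))"
      by (rule integrable_mult_ess_bdd[OF G])
    have l: "AE t in circ. (\<lambda>n. (cmod (poly (p n * s) (cis t)))\<^sup>2 * v t) \<longlonglongrightarrow> (cmod (\<phi> (cis t)))\<^sup>2 * v t * (cmod (poly s (cis t)))\<^sup>2"
      using lim
    proof eventually_elim
      case (elim t)
      then have "(\<lambda>n. (cmod (poly (p n) (cis t)))\<^sup>2 * v t * (cmod (poly s (cis t)))\<^sup>2) \<longlonglongrightarrow> (cmod (\<phi> (cis t)))\<^sup>2 * v t * (cmod (poly s (cis t)))\<^sup>2"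
        by (intro tendsto_intros)
      then show ?case by (simp add: norm_mult power_mult_distrib mult_ac)
    qed
    have b: "AE t in circ. norm ((cmod (poly (p n * s) (cis t)))\<^sup>2 * v t) \<le> G t * (v t * (cmod (poly s (cis t)))\<^sup>2)" for n
      using AG vge
    proof eventually_elim
      case (elim t)
      have "(cmod (poly (p n) (cis t)))\<^sup>2 * (v t * (cmod (poly s (cis t)))\<^sup>2) \<le> G t * (v t * (cmod (poly s (cis t)))\<^sup>2)"
        using elim m by (intro mult_right_mono) auto
      moreover have "0 \<le> v t" using elim m by simp
      ultimately show ?case by (simp add: norm_mult power_mult_distrib abs_mult mult_ac)
    qed
    show "(\<lambda>n. I (p n * s)) \<longlonglongrightarrow> (LINT t|circ. (cmod (\<phi> (cis t)))\<^sup>2 * v t * (cmod (poly s (cis t)))\<^sup>2)"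
      unfolding I_def by (rule integral_dominated_convergence[OF _ _ w l b]) measurable
    show "integrable circ (\<lambda>t. (cmod (\<phi> (cis t)))\<^sup>2 * v t * (cmod (poly s (cis t)))\<^sup>2)"
      by (rule integrable_dominated_convergence[OF _ _ w l b]) measurable
  qed
  define W where "W t = (cmod (\<phi> (cis t)))\<^sup>2 * v t" for t
  have W: "integrable circ W" using Iint[of 1] by (simp add: W_def[abs_def])
  have D'ge: "D' \<le> (LINT t|circ. W t * (cmod (poly s (cis t)))\<^sup>2)" if "poly s 0 = 1" for s
    unfolding W_def using Ilim[of s] by (rule LIMSEQ_le_const) (auto intro!: D'le simp: p0 that)
  have WD': "(LINT t|circ. W t) = D'"
  proof (rule antisym)
    show "D' \<le> (LINT t|circ. W t)" using D'ge[of 1] by simp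
    have "(\<lambda>n. D' + (1/4) ^ n) \<longlonglongrightarrow> D' + 0"
      by (intro tendsto_intros LIMSEQ_realpow_zero) auto
    moreover have "(\<lambda>n. I (p n)) \<longlonglongrightarrow> (LINT t|circ. W t)"
      using Ilim[of 1] by (simp add: W_def)
    ultimately show "(LINT t|circ. W t) \<le> D'"
      using pI by (intro LIMSEQ_le[of "\<lambda>n. I (p n)" _ "\<lambda>n. D' + (1/4) ^ n"]) (auto intro: less_imp_le)
  qed
  have J0: "(LINT t|circ. W t * cis (of_nat k * t)) = 0" if k: "0 < k" for k
  proof -
    define J where "J = (LINT t|circ. W t * cis (of_nat k * t))"
    have iJ: "integrable circ (\<lambda>t. W t * cis (of_nat k * t))"
      using W by (intro integrable_mult_ess_bdd) (auto simp: complex_of_real_integrable_eq)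
    have quad: "0 \<le> (cmod \<alpha>)\<^sup>2 * D' + 2 * Re (\<alpha> * J)" for \<alpha>
    proof -
      have sq: "W t * (cmod (poly (1 + monom \<alpha> k) (cis t)))\<^sup>2
          = (1 + (cmod \<alpha>)\<^sup>2) * W t + 2 * Re (\<alpha> * (W t * cis (of_nat k * t)))" for t
      proof -
        have "(cmod (1 + z))\<^sup>2 = 1 + (cmod z)\<^sup>2 + 2 * Re z" for z
          unfolding cmod_power2 by (simp add: power2_eq_square algebra_simps)
        then have e1: "(cmod (poly (1 + monom \<alpha> k) (cis t)))\<^sup>2 = 1 + (cmod \<alpha>)\<^sup>2 + 2 * Re (\<alpha> * cis (of_nat k * t))"
          by (simp add: poly_monom Complex.DeMoivre norm_mult)
        have e2: "Re (\<alpha> * (W t * cis (of_nat k * t))) = W t * Re (\<alpha> * cis (of_nat k * t))"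
          by (simp add: algebra_simps)
        show ?thesis unfolding e1 e2 by (simp only: ring_distribs mult_ac mult_1_right)
      qed
      have "D' \<le> (LINT t|circ. W t * (cmod (poly (1 + monom \<alpha> k) (cis t)))\<^sup>2)"
        using k by (intro D'ge) (simp add: poly_monom)
      also have "\<dots> = (1 + (cmod \<alpha>)\<^sup>2) * D' + 2 * Re (\<alpha> * J)"
      proof -
        have i: "integrable circ (\<lambda>t. \<alpha> * (W t * cis (of_nat k * t)))"
          using iJ by (rule integrable_mult_right)
        have "(LINT t|circ. Re (\<alpha> * (W t * cis (of_nat k * t)))) = Re (\<alpha> * J)"
          unfolding integral_Re[OF i] integral_mult_right_zero J_def ..
        then show ?thesis
          unfolding sq
          by (subst Bochner_Integration.integral_add,
              intro integrable_mult_right W, intro integrable_mult_right integrable_Re i)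
             (simp only: integral_mult_right_zero WD')
      qed
      finally show ?thesis by (simp add: algebra_simps)
    qed
    \<comment> \<open>With \<open>\<alpha> = - \<eta> * cnj J\<close> the inequality reads
      \<open>0 \<le> \<eta> * |J|^2 * (\<eta> * D' - 2)\<close>. The added 1 avoids dividing by
      \<open>D'\<close>, whose positivity is not yet known.\<close>
    define \<eta> where "\<eta> = 1 / (D' + 1)"
    have \<eta>: "0 < \<eta>" "\<eta> * D' \<le> 1" using D'0 by (auto simp: \<eta>_def)
    have "Re (- \<eta> * cnj J * J) = - \<eta> * (cmod J)\<^sup>2"
      unfolding cmod_power2 by (simp add: power2_eq_square algebra_simps)
    then have "0 \<le> \<eta> * (cmod J)\<^sup>2 * (\<eta> * D' - 2)"
      using quad[of "- \<eta> * cnj J"] \<eta> by (simp add: norm_mult power_mult_distrib power2_eq_square algebra_simps)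
    moreover have "\<eta> * (cmod J)\<^sup>2 * (\<eta> * D' - 2) < 0" if "J \<noteq> 0"
      using that \<eta> by (intro mult_pos_neg) auto
    ultimately show ?thesis unfolding J_def[symmetric] by force
  qed
  define D where "D = D' / (2 * pi)"
  have WD: "AE t in circ. W t = D"
    by (rule AE_eq_const_of_fourier[OF W J0]) (auto simp: WD' D_def)
  have D0: "0 \<le> D" using D'0 by (simp add: D_def)
  \<comment> \<open>Constancy of \<open>|\<phi>|^2 v\<close> and the lower bound on \<open>v\<close>
    turn the \<open>L^2\<close> limit into a bounded symbol.\<close>
  have \<phi>b: "AE t in circ. (cmod (\<phi> (cis t)))\<^sup>2 \<le> D / m"
    using WD vge
  proof eventually_elim
    case (elim t)
    have "(cmod (\<phi> (cis t)))\<^sup>2 * m \<le> (cmod (\<phi> (cis t)))\<^sup>2 * v t"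
      using elim by (intro mult_left_mono) auto
    then show ?case using elim m by (simp add: W_def field_simps)
  qed
  then have "AE t in circ. cmod (\<phi> (cis t)) \<le> sqrt (D / m)"
    by eventually_elim (rule real_le_rsqrt)
  then have \<phi>L: "\<phi> \<in> Linf_circle"
    unfolding Linf_circle_iff by (rule ess_bddI[OF \<phi>m])
  \<comment> \<open>The majorant comes from \<open>2 |p| \<le> 1 + |p|^2\<close>. In the limit
    \<open>\<phi>\<close> inherits the vanishing negative coefficients and the zeroth coefficient
    1.\<close>
  have flim: "(\<lambda>n. fcoeff (\<lambda>t. poly (p n) (cis t)) k) \<longlonglongrightarrow> fourier_coeff \<phi> k" for k
    unfolding fourier_coeff_eq fcoeff_def
  proof (intro tendsto_intros integral_dominated_convergence)
    show "integrable circ (\<lambda>t. 1 + G t)" using G by simp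
    show "AE t in circ. (\<lambda>n. poly (p n) (cis t) * cis (- (of_int k * t))) \<longlonglongrightarrow> \<phi> (cis t) * cis (- (of_int k * t))"
      using lim by eventually_elim (intro tendsto_intros)
    show "AE t in circ. norm (poly (p n) (cis t) * cis (- (of_int k * t))) \<le> 1 + G t" for n
      using AG
    proof eventually_elim
      case (elim t)
      have "2 * cmod (poly (p n) (cis t)) \<le> 1 + (cmod (poly (p n) (cis t)))\<^sup>2"
        using sum_squares_bound[of "cmod (poly (p n) (cis t))" 1] by simp
      then have "cmod (poly (p n) (cis t)) \<le> 1 + (cmod (poly (p n) (cis t)))\<^sup>2"
        using norm_ge_zero[of "poly (p n) (cis t)"] by linarith
      then show ?case using elim by (simp add: norm_mult) (meson add_left_mono order_trans)
    qed
  qed (use cis_m[of "- of_int k"] in simp_all)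
  have f_neg: "fourier_coeff \<phi> n = 0" if "n < 0" for n
    using flim[of n] that by (simp add: fcoeff_poly_1 LIMSEQ_const_iff)
  have f_0: "fourier_coeff \<phi> 0 = 1"
    using flim[of 0] p0 by (simp add: fcoeff_poly_1 LIMSEQ_const_iff poly_0_coeff_0)
  have "D \<noteq> 0"
  proof
    assume "D = 0"
    have "AE t in circ. \<phi> (cis t) = 0" using \<phi>b by eventually_elim (simp add: \<open>D = 0\<close>)
    then have "(LINT t|circ. \<phi> (cis t) * cis (- (of_int 0 * t))) = (LINT t|circ. 0)"
      by (intro integral_cong_AE) (auto elim: eventually_mono)
    then show False using f_0 by (simp add: fourier_coeff_def)
  qed
  then have "0 < D" using D0 by simp
  moreover have "D \<le> 1 / (2*pi) * (LINT t|circ. v t)"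
    using D'le[of 1] by (simp add: D_def I_def divide_right_mono)
  ultimately show ?thesis
    using \<phi>L WD f_neg f_0 unfolding W_def by blast
qed

section \<open>Quadratic forms of Toeplitz operators\<close>

text \<open>Truncation keeps a vector supported in \<open>A\<close> and turns it into a polynomial,
  and the truncations converge to the vector.\<close>

lemma closed_Collect_ell2_of_poly:
  assumes closed: "closed {x. P x}" and x: "diag_proj A x = x"
    and poly: "\<And>q. diag_proj A (ell2_of_poly q) = ell2_of_poly q \<Longrightarrow> P (ell2_of_poly q)"
  shows "P x"
proof -
  have "P (diag_proj {..<n} x)" for n
  proof -
    obtain q where q: "diag_proj {..<n} x = ell2_of_poly q"
      using diag_proj_lessThan_poly by blast
    have "diag_proj A (diag_proj {..<n} x) = diag_proj {..<n} x"
      using x by (metis diag_proj_diag_proj inf_commute)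
    then show ?thesis using poly[of q] q by simp
  qed
  then have "\<And>n. diag_proj {..<n} x \<in> {x. P x}" by simp
  then have "x \<in> {x. P x}"
    by (rule closed_sequentially[OF closed]) (rule diag_proj_lessThan_tendsto)
  then show ?thesis by simp
qed

lemma continuous_on_toeplitz [continuous_intros]:
  "f \<in> Linf_circle \<Longrightarrow> continuous_on S (toeplitz f)"
  using bounded_linear.continuous_on[OF bounded_linear_toeplitz continuous_on_id] by simp

text \<open>Since \<open>|q|^2\<close> is real, the real inner product sees only the real part of
  the symbol.\<close>

lemma inner_toeplitz_poly:
  fixes f :: "complex \<Rightarrow> complex"
  assumes f: "f \<in> Linf_circle"
  shows "inner (toeplitz f (ell2_of_poly q)) (ell2_of_poly q)
    = 1 / (2*pi) * (LINT t|circ. Re (f (cis t)) * (cmod (poly q (cis t)))\<^sup>2)"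
proof -
  have i: "integrable circ (\<lambda>t. f (cis t) * of_real ((cmod (poly q (cis t)))\<^sup>2))"
    using f unfolding Linf_circle_iff
    by (intro ess_bdd_integrable ess_bdd_mult ess_bdd_of_real ess_bdd_power2 ess_bdd_cmod ess_bdd_poly)
  have "inner (toeplitz f (ell2_of_poly q)) (ell2_of_poly q)
      = Re (of_real (1 / (2*pi)) * (LINT t|circ. f (cis t) * of_real ((cmod (poly q (cis t)))\<^sup>2)))"
    unfolding Re_cinner[symmetric] cinner_toeplitz_poly[OF f] by simp
  also have "\<dots> = 1 / (2*pi) * Re (LINT t|circ. f (cis t) * of_real ((cmod (poly q (cis t)))\<^sup>2))"
    by (simp only: times_complex.sel Re_complex_of_real Im_complex_of_real mult_zero_left diff_0_right)
  also have "Re (LINT t|circ. f (cis t) * of_real ((cmod (poly q (cis t)))\<^sup>2))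
      = (LINT t|circ. Re (f (cis t)) * (cmod (poly q (cis t)))\<^sup>2)"
    unfolding integral_Re[OF i, symmetric] by simp
  finally show ?thesis .
qed

lemma abs_inner_toeplitz_le:
  assumes "f \<in> Linf_circle"
  shows "\<bar>inner (toeplitz f x) x\<bar> \<le> onorm (toeplitz f) * (norm x)\<^sup>2"
proof -
  have "\<bar>inner (toeplitz f x) x\<bar> \<le> norm (toeplitz f x) * norm x"
    by (rule Cauchy_Schwarz_ineq2)
  also have "\<dots> \<le> onorm (toeplitz f) * norm x * norm x"
    by (intro mult_right_mono onorm bounded_linear_toeplitz assms) auto
  finally show ?thesis by (simp add: power2_eq_square mult.assoc)
qed

lemma inner_self_adjoint: "self_adjoint T \<Longrightarrow> inner (T x) y = inner x (T y)"
  by (simp add: self_adjoint_def flip: Re_cinner)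

lemma inner_diag_proj: "inner (diag_proj A x) y = inner x (diag_proj A y)"
  unfolding Re_cinner[symmetric] cinner_def
  by (intro arg_cong[where f=Re] arg_cong[where f=suminf]) auto

text \<open>\<open>h\<close> and \<open>f\<close> have the same real quadratic form, and the norm of
  a self-adjoint operator is governed by its form. The norm comparison thus avoids any estimate on
  the supremum of \<open>f\<close>.\<close>

lemma Re_symbol:
  fixes f :: "complex \<Rightarrow> complex"
  assumes f: "f \<in> Linf_circle"
  defines "h \<equiv> \<lambda>z. complex_of_real (Re (f z))"
  shows "h \<in> Linf_circle" "fourier_coeff h n = (fourier_coeff f n + cnj (fourier_coeff f (- n))) / 2"
    "self_adjoint (toeplitz h)" "onorm (toeplitz h) \<le> onorm (toeplitz f)"
proof -
  show h: "h \<in> Linf_circle"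
    using f by (auto simp: Linf_circle_iff h_def)
  have fc: "fourier_coeff h n = (fourier_coeff f n + cnj (fourier_coeff f (- n))) / 2" for n
  proof -
    have "h z = (1/2) * f z + (1/2) * cnj (f z)" for z
      by (simp add: h_def complex_eq_iff)
    then have "fourier_coeff h n = fcoeff (\<lambda>t. (1/2) * f (cis t) + (1/2) * cnj (f (cis t))) n"
      unfolding fourier_coeff_eq by presburger
    also have "\<dots> = (1/2) * fcoeff (\<lambda>t. f (cis t)) n + (1/2) * fcoeff (\<lambda>t. cnj (f (cis t))) n"
      using f unfolding Linf_circle_iff
      by (subst fcoeff_add) (auto simp only: fcoeff_cmult intro!: ess_bdd_mult ess_bdd_const ess_bdd_cnj)
    finally show ?thesis by (simp add: fcoeff_cnj fourier_coeff_eq add_divide_distrib)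
  qed
  then show "fourier_coeff h n = (fourier_coeff f n + cnj (fourier_coeff f (- n))) / 2" .
  show sa: "self_adjoint (toeplitz h)"
    unfolding self_adjoint_toeplitz_iff[OF h] fc by (simp add: add.commute)
  have "inner (toeplitz h x) x = inner (toeplitz f x) x" for x
  proof (rule closed_Collect_ell2_of_poly[where A = UNIV and P = "\<lambda>x. inner (toeplitz h x) x = inner (toeplitz f x) x"])
    show "closed {x. inner (toeplitz h x) x = inner (toeplitz f x) x}"
      using f h by (intro closed_Collect_eq continuous_intros)
    show "inner (toeplitz h (ell2_of_poly q)) (ell2_of_poly q) = inner (toeplitz f (ell2_of_poly q)) (ell2_of_poly q)" for q
      unfolding inner_toeplitz_poly[OF h] inner_toeplitz_poly[OF f] by (simp add: h_def)
  qed (auto intro: ell2_eqI)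
  then have "\<bar>inner (toeplitz h x) x\<bar> \<le> onorm (toeplitz f) * (norm x)\<^sup>2" for x
    using abs_inner_toeplitz_le[OF f, of x] by simp
  then have "norm (toeplitz h x) \<le> onorm (toeplitz f) * norm x" for x
    by (intro norm_le_of_quadratic_form inner_self_adjoint sa
        bounded_linear.linear[OF bounded_linear_toeplitz[OF h]])
  then show "onorm (toeplitz h) \<le> onorm (toeplitz f)"
    by (intro onorm_bound onorm_pos_le bounded_linear_toeplitz f)
qed

text \<open>Multiplication by \<open>- \<i>\<close> turns the imaginary part into a real part, so
  \<open>Re_symbol\<close> serves for both.\<close>

lemma onorm_toeplitz_uminus_ii:
  assumes f: "f \<in> Linf_circle"
  shows "(\<lambda>z. - \<i> * f z) \<in> Linf_circle" "fourier_coeff (\<lambda>z. - \<i> * f z) n = - \<i> * fourier_coeff f n"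
    "onorm (toeplitz (\<lambda>z. - \<i> * f z)) \<le> onorm (toeplitz f)"
proof -
  show g: "(\<lambda>z. - \<i> * f z) \<in> Linf_circle"
    using f unfolding Linf_circle_iff by (intro ess_bdd_mult ess_bdd_const)
  have fc: "fourier_coeff (\<lambda>z. - \<i> * f z) n = - \<i> * fourier_coeff f n" for n
    unfolding fourier_coeff_eq by (rule fcoeff_cmult)
  then show "fourier_coeff (\<lambda>z. - \<i> * f z) n = - \<i> * fourier_coeff f n" .
  have lc: "fourier_coeff (\<lambda>z. - \<i> * f z) n = - \<i> * fourier_coeff f n + 0 * fourier_coeff f n" for n
    unfolding fc by simp
  have "toeplitz (\<lambda>z. - \<i> * f z) x = - imult (toeplitz f x)" for x
    by (rule ell2_eqI) (simp only: toeplitz_lin_comb[OF f f g lc], simp)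
  then have "norm (toeplitz (\<lambda>z. - \<i> * f z) x) \<le> onorm (toeplitz f) * norm x" for x
    using onorm[OF bounded_linear_toeplitz[OF f], of x] by simp
  then show "onorm (toeplitz (\<lambda>z. - \<i> * f z)) \<le> onorm (toeplitz f)"
    by (intro onorm_bound onorm_pos_le bounded_linear_toeplitz f)
qed

text \<open>The real and imaginary parts of \<open>f\<close> have mean zero because \<open>f\<close>
  does. On an intersection of their blocks the two errors add up, which is the factor 2.\<close>

lemma analytic_paving_of_self_adjoint_paving:
  assumes i: "\<And>h. h \<in> Linf_circle \<Longrightarrow> self_adjoint (toeplitz h) \<Longrightarrow> fourier_coeff h 0 = 0 \<Longrightarrow>
      \<exists>A. paving r A \<and> (\<forall>i\<in>{1..r}. onorm (diag_proj (A i) \<circ> toeplitz h \<circ> diag_proj (A i)) \<le> \<epsilon> * onorm (toeplitz h))"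
    and \<epsilon>: "0 < \<epsilon>" and f: "f \<in> Hinf0_circle"
  shows "\<exists>A. paving (r * r) A \<and>
    (\<forall>i\<in>{1..r * r}. onorm (diag_proj (A i) \<circ> toeplitz f \<circ> diag_proj (A i)) \<le> 2 * \<epsilon> * onorm (toeplitz f))"
proof -
  have fL: "f \<in> Linf_circle" and f0: "fourier_coeff f 0 = 0"
    using f by (auto simp: Hinf0_circle_def)
  note g = onorm_toeplitz_uminus_ii[OF fL]
  define h where "h = (\<lambda>z. complex_of_real (Re (f z)))"
  define k where "k = (\<lambda>z. complex_of_real (Re (- \<i> * f z)))"
  note h = Re_symbol[OF fL, folded h_def] and k = Re_symbol[OF g(1), folded k_def]
  have "fourier_coeff h 0 = 0" unfolding h(2) by (simp add: f0)
  from i[OF h(1,3) this] obtain A where A: "paving r A"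
    "\<And>i. i \<in> {1..r} \<Longrightarrow> onorm (diag_proj (A i) \<circ> toeplitz h \<circ> diag_proj (A i)) \<le> \<epsilon> * onorm (toeplitz h)"
    by blast
  have "fourier_coeff k 0 = 0" unfolding k(2) g(2) by (simp add: f0)
  from i[OF k(1,3) this] obtain B where B: "paving r B"
    "\<And>i. i \<in> {1..r} \<Longrightarrow> onorm (diag_proj (B i) \<circ> toeplitz k \<circ> diag_proj (B i)) \<le> \<epsilon> * onorm (toeplitz k)"
    by blast
  obtain C where C: "paving (r * r) C"
    "\<And>l. l \<in> {1..r * r} \<Longrightarrow> \<exists>i\<in>{1..r}. \<exists>j\<in>{1..r}. C l = A i \<inter> B j"
    using paving_common_refinement[OF A(1) B(1)] by blast
  let ?M = "onorm (toeplitz f)"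
  have M0: "0 \<le> ?M" by (intro onorm_pos_le bounded_linear_toeplitz fL)
  have split: "toeplitz f x = toeplitz h x + imult (toeplitz k x)" for x
  proof (rule ell2_eqI)
    fix i
    have lc: "fourier_coeff f n = 1 * fourier_coeff h n + \<i> * fourier_coeff k n" for n
      unfolding h(2) k(2) g(2) by (simp add: field_simps)
    show "coord (toeplitz f x) i = coord (toeplitz h x + imult (toeplitz k x)) i"
      unfolding toeplitz_lin_comb[OF h(1) k(1) fL lc] by simp
  qed
  \<comment> \<open>A bound on the block \<open>F\<close> survives on each subset \<open>E\<close>,
    since compressing to \<open>E\<close> factors through compressing to \<open>F\<close>.\<close>
  have block: "norm (diag_proj E (toeplitz s x)) \<le> \<epsilon> * ?M * norm x"
    if s: "s \<in> Linf_circle" "onorm (toeplitz s) \<le> ?M"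
      and on: "onorm (diag_proj F \<circ> toeplitz s \<circ> diag_proj F) \<le> \<epsilon> * onorm (toeplitz s)"
      and E: "E \<subseteq> F" "diag_proj E x = x" for s E F x
  proof -
    have EF: "E \<inter> F = E" "F \<inter> E = E" using E(1) by auto
    have Fx: "diag_proj F x = x" using E(2) EF(2) by (metis diag_proj_diag_proj)
    have "norm (diag_proj E (toeplitz s x)) = norm (diag_proj E (diag_proj F (toeplitz s x)))"
      by (simp add: diag_proj_diag_proj EF)
    also have "\<dots> \<le> norm (diag_proj F (toeplitz s x))" by (rule norm_diag_proj_le)
    also have "\<dots> \<le> onorm (diag_proj F \<circ> toeplitz s \<circ> diag_proj F) * norm x"
      by (rule norm_compression_le[OF bounded_linear_toeplitz[OF s(1)] Fx])
    also have "\<dots> \<le> \<epsilon> * ?M * norm x"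
    proof (rule mult_right_mono)
      show "onorm (diag_proj F \<circ> toeplitz s \<circ> diag_proj F) \<le> \<epsilon> * ?M"
        using on mult_left_mono[OF s(2), of \<epsilon>] \<epsilon> by linarith
    qed simp
    finally show ?thesis .
  qed
  have "onorm (diag_proj (C l) \<circ> toeplitz f \<circ> diag_proj (C l)) \<le> 2 * \<epsilon> * ?M" if l: "l \<in> {1..r * r}" for l
  proof (rule onorm_compression_le)
    fix x assume x: "diag_proj (C l) x = x"
    obtain i j where ij: "i \<in> {1..r}" "j \<in> {1..r}" "C l = A i \<inter> B j" using C(2)[OF l] by blast
    have "diag_proj (C l) (toeplitz f x) = diag_proj (C l) (toeplitz h x) + imult (diag_proj (C l) (toeplitz k x))"
      unfolding split by (rule ell2_eqI) simp
    then have "norm (diag_proj (C l) (toeplitz f x)) \<le> norm (diag_proj (C l) (toeplitz h x)) + norm (diag_proj (C l) (toeplitz k x))"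
      by (metis norm_triangle_ineq norm_imult)
    also have "\<dots> \<le> \<epsilon> * ?M * norm x + \<epsilon> * ?M * norm x"
      using ij x h k g
      by (intro add_mono block[of _ "A i"] block[of _ "B j"] A(2) B(2)) (auto intro: order_trans)
    finally show "norm (diag_proj (C l) (toeplitz f x)) \<le> 2 * \<epsilon> * ?M * norm x"
      by (simp only: mult_2 distrib_right)
  qed (use \<epsilon> M0 in simp)
  then show ?thesis using C(1) by blast
qed

section \<open>Paving self-adjoint Toeplitz operators through analytic factors\<close>

text \<open>Here \<open>f = g - a\<close>, where \<open>|g|^2 = 1 + \<delta> u\<close> almost
  everywhere and \<open>a\<close> is the mean of \<open>g\<close>; the last clause bounds the image
  under \<open>T_g\<close> by the quadratic form of \<open>|g|^2\<close>.\<close>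

lemma toeplitz_analytic_factor:
  fixes u :: "complex \<Rightarrow> real"
  assumes u: "(\<lambda>z. complex_of_real (u z)) \<in> Linf_circle" and u1: "AE t in circ. \<bar>u (cis t)\<bar> \<le> 1"
    and u0: "(LINT t|circ. u (cis t)) = 0" and \<delta>: "0 < \<delta>" "\<delta> \<le> 1/2"
  shows "\<exists>f\<in>Hinf0_circle. \<exists>a>0. a \<le> 1 \<and> 1 - 2 * \<delta>\<^sup>2 \<le> a\<^sup>2 \<and> onorm (toeplitz f) \<le> 3 \<and>
    (\<forall>x. (norm (a *\<^sub>R x + toeplitz f x))\<^sup>2 \<le> (norm x)\<^sup>2 + \<delta> * inner (toeplitz (\<lambda>z. complex_of_real (u z)) x) x)"
proof -
  let ?u = "\<lambda>t. u (cis t)" and ?U = "\<lambda>z. complex_of_real (u z)"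
  have ub: "ess_bdd ?u"
    using ess_bdd_Re[of "\<lambda>t. ?U (cis t)"] u by (simp add: Linf_circle_iff)
  note um [measurable] = ess_bdd_measurable[OF ub]
  define w where "w t = 1 + \<delta> * ?u t" for t
  have wb: "ess_bdd w" unfolding w_def using ub by auto
  have wr: "AE t in circ. 1/2 \<le> w t \<and> w t \<le> 3/2"
    using u1
  proof eventually_elim
    case (elim t)
    have "\<bar>\<delta> * ?u t\<bar> \<le> (1/2) * 1"
      unfolding abs_mult using elim \<delta> by (intro mult_mono) auto
    then show ?case by (auto simp: w_def abs_le_iff)
  qed
  define v where "v t = 1 / w t" for t
  have vm: "v \<in> borel_measurable circ"
    unfolding v_def using ess_bdd_measurable[OF wb] by (intro borel_measurable_divide) auto
  have vge: "AE t in circ. 1/2 \<le> v t"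
    using wr by eventually_elim (auto simp: v_def field_simps)
  have vle: "AE t in circ. v t \<le> 2"
    using wr by eventually_elim (auto simp: v_def field_simps)
  obtain \<phi> D where \<phi>: "\<phi> \<in> Linf_circle" and D: "0 < D" "D \<le> 1 / (2*pi) * (LINT t|circ. v t)"
    and \<phi>v: "AE t in circ. (cmod (\<phi> (cis t)))\<^sup>2 * v t = D"
    and \<phi>neg: "\<And>n. n < 0 \<Longrightarrow> fourier_coeff \<phi> n = 0" and \<phi>0: "fourier_coeff \<phi> 0 = 1"
    using szego_factorization[OF vm _ vge vle] by auto
  have vint: "integrable circ v"
  proof (rule ess_bdd_integrable, rule ess_bddI[OF vm])
    show "AE t in circ. norm (v t) \<le> 2" using vge vle by eventually_elim auto
  qed
  \<comment> \<open>The pointwise bound is \<open>1 / (1 + y) \<le> 1 - y + 2 y^2\<close>, valid for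
    \<open>y = \<delta> u \<ge> -1/2\<close>; the linear term integrates to zero.\<close>
  have "(LINT t|circ. v t) \<le> (LINT t|circ. 1 + 2 * \<delta>\<^sup>2 - \<delta> * ?u t)"
  proof (rule integral_mono_AE)
    show "AE t in circ. v t \<le> 1 + 2 * \<delta>\<^sup>2 - \<delta> * ?u t"
      using u1 wr
    proof eventually_elim
      case (elim t)
      define y where "y = \<delta> * ?u t"
      have w: "w t = 1 + y" by (simp add: w_def y_def)
      have y2: "y\<^sup>2 \<le> \<delta>\<^sup>2"
        unfolding y_def power_mult_distrib using elim by (intro mult_left_le) (auto simp: abs_square_le_1)
      have "1 \<le> (1 + 2 * y\<^sup>2 - y) * (1 + y)"
      proof -
        have "(1 + 2 * y\<^sup>2 - y) * (1 + y) = 1 + y\<^sup>2 * (1 + 2 * y)"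
          by (simp add: power2_eq_square algebra_simps)
        moreover have "0 \<le> y\<^sup>2 * (1 + 2 * y)" using elim w by simp
        ultimately show ?thesis by linarith
      qed
      then have "v t \<le> 1 + 2 * y\<^sup>2 - y"
        using elim w by (simp add: v_def pos_divide_le_eq)
      then show ?case using y2 by (simp add: y_def[symmetric])
    qed
    show "integrable circ v" by (rule vint)
    show "integrable circ (\<lambda>t. 1 + 2 * \<delta>\<^sup>2 - \<delta> * ?u t)" using ub by (auto intro!: ess_bdd_integrable)
  qed
  also have "\<dots> = 2 * pi * (1 + 2 * \<delta>\<^sup>2)"
    using ess_bdd_integrable[OF ub] u0
    by (subst Bochner_Integration.integral_diff) (auto simp: measure_restrict_space)
  finally have "1 / (2*pi) * (LINT t|circ. v t) \<le> 1 / (2*pi) * (2 * pi * (1 + 2 * \<delta>\<^sup>2))"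
    by (intro mult_left_mono) auto
  then have D2: "D \<le> 1 + 2 * \<delta>\<^sup>2" using D(2) by simp
  \<comment> \<open>Normalizes \<open>|g|^2\<close> to \<open>w\<close>; since \<open>\<phi>\<close>
    has zeroth coefficient 1, that of \<open>g\<close> is \<open>a\<close>.\<close>
  define a where "a = 1 / sqrt D"
  have a0: "0 < a" and a2: "a\<^sup>2 = 1 / D" using D(1) by (auto simp: a_def power_divide)
  have a2ge: "1 - 2 * \<delta>\<^sup>2 \<le> a\<^sup>2"
  proof -
    have "(1 - 2 * \<delta>\<^sup>2) * D \<le> 1"
    proof (cases "0 \<le> 1 - 2 * \<delta>\<^sup>2")
      case True
      have "(1 - 2 * \<delta>\<^sup>2) * D \<le> (1 - 2 * \<delta>\<^sup>2) * (1 + 2 * \<delta>\<^sup>2)" by (rule mult_left_mono[OF D2 True])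
      also have "\<dots> = 1 - (2 * \<delta>\<^sup>2)\<^sup>2" by (simp add: power2_eq_square algebra_simps)
      also have "\<dots> \<le> 1" by simp
      finally show ?thesis .
    next
      case False
      then have "(1 - 2 * \<delta>\<^sup>2) * D \<le> 0" using D(1) by (intro mult_nonpos_nonneg) auto
      then show ?thesis by simp
    qed
    then show ?thesis using D(1) by (simp add: a2 pos_le_divide_eq)
  qed
  define g where "g = (\<lambda>z. complex_of_real a * \<phi> z)"
  have gL: "g \<in> Linf_circle" using \<phi> by (auto simp: g_def Linf_circle_iff)
  have gc: "fourier_coeff g n = a * fourier_coeff \<phi> n" for n
    unfolding g_def fourier_coeff_eq by (rule fcoeff_cmult)
  have gw: "AE t in circ. (cmod (g (cis t)))\<^sup>2 = w t"
    using \<phi>v wr by eventually_elim (use D in \<open>auto simp: g_def norm_mult power_mult_distrib a2 v_def field_simps\<close>)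
  have gq: "(LINT t|circ. (cmod (g (cis t)))\<^sup>2 * (cmod (poly q (cis t)))\<^sup>2) = (LINT t|circ. w t * (cmod (poly q (cis t)))\<^sup>2)" for q
  proof (rule integral_cong_AE)
    have "ess_bdd (\<lambda>t. (cmod (g (cis t)))\<^sup>2 * (cmod (poly q (cis t)))\<^sup>2)"
      using gL by (auto simp: Linf_circle_iff)
    then show "(\<lambda>t. (cmod (g (cis t)))\<^sup>2 * (cmod (poly q (cis t)))\<^sup>2) \<in> borel_measurable circ"
      by (rule ess_bdd_measurable)
    have "ess_bdd (\<lambda>t. w t * (cmod (poly q (cis t)))\<^sup>2)"
      using wb by auto
    then show "(\<lambda>t. w t * (cmod (poly q (cis t)))\<^sup>2) \<in> borel_measurable circ"
      by (rule ess_bdd_measurable)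
  qed (use gw in \<open>auto elim!: eventually_mono\<close>)
  have wq: "1 / (2*pi) * (LINT t|circ. w t * (cmod (poly q (cis t)))\<^sup>2)
      = (norm (ell2_of_poly q))\<^sup>2 + \<delta> * inner (toeplitz ?U (ell2_of_poly q)) (ell2_of_poly q)" for q
  proof -
    have "(LINT t|circ. w t * (cmod (poly q (cis t)))\<^sup>2)
        = (LINT t|circ. (cmod (poly q (cis t)))\<^sup>2 + \<delta> * (?u t * (cmod (poly q (cis t)))\<^sup>2))"
      by (simp add: w_def algebra_simps)
    also have "\<dots> = (LINT t|circ. (cmod (poly q (cis t)))\<^sup>2) + \<delta> * (LINT t|circ. ?u t * (cmod (poly q (cis t)))\<^sup>2)"
      using ub by (subst Bochner_Integration.integral_add) (auto intro!: ess_bdd_integrable)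
    finally show ?thesis
      unfolding inner_toeplitz_poly[OF u] integral_cmod_poly_power2 by (simp add: field_simps)
  qed
  have Tg: "(norm (toeplitz g x))\<^sup>2 \<le> (norm x)\<^sup>2 + \<delta> * inner (toeplitz ?U x) x" for x
  proof (rule closed_Collect_ell2_of_poly[where A = UNIV and P = "\<lambda>x. (norm (toeplitz g x))\<^sup>2 \<le> (norm x)\<^sup>2 + \<delta> * inner (toeplitz ?U x) x"])
    show "closed {x. (norm (toeplitz g x))\<^sup>2 \<le> (norm x)\<^sup>2 + \<delta> * inner (toeplitz ?U x) x}"
      using gL u by (intro closed_Collect_le continuous_intros)
    show "(norm (toeplitz g (ell2_of_poly q)))\<^sup>2 \<le> (norm (ell2_of_poly q))\<^sup>2
        + \<delta> * inner (toeplitz ?U (ell2_of_poly q)) (ell2_of_poly q)" for q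
      using norm_toeplitz_poly_power2_le[OF gL, of q] unfolding gq wq .
  qed (auto intro: ell2_eqI)
  \<comment> \<open>Bessel's inequality at the single frequency 0: \<open>a^2\<close> is at most the
    mean of \<open>|g|^2 = w\<close>, which is 1.\<close>
  have a1: "a \<le> 1"
  proof -
    have "(\<Sum>i<1. (cmod (fcoeff (\<lambda>t. g (cis t)) (int i)))\<^sup>2) \<le> 1 / (2*pi) * (LINT t|circ. (cmod (g (cis t)))\<^sup>2)"
      using gL by (intro bessel_inequality) (simp add: Linf_circle_iff)
    also have "\<dots> = 1 / (2*pi) * (LINT t|circ. w t)" using gq[of 1] by simp
    also have "(LINT t|circ. w t) = 2 * pi"
      unfolding w_def using ess_bdd_integrable[OF ub] u0
      by (subst Bochner_Integration.integral_add) (auto simp: measure_restrict_space)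
    finally have "(cmod (fourier_coeff g 0))\<^sup>2 \<le> 1" by (simp add: fourier_coeff_eq)
    then have "a\<^sup>2 \<le> 1" using \<phi>0 by (simp add: gc)
    then show ?thesis by (simp add: abs_square_le_1)
  qed
  define f where "f = (\<lambda>z. g z - complex_of_real a)"
  have fL: "f \<in> Linf_circle" using gL by (auto simp: f_def Linf_circle_iff)
  have fc: "fourier_coeff f n = fourier_coeff g n - (if n = 0 then complex_of_real a else 0)" for n
    unfolding f_def fourier_coeff_eq using gL
    by (subst fcoeff_diff) (auto simp: Linf_circle_iff fcoeff_const)
  have fH: "f \<in> Hinf0_circle"
    using fL \<phi>neg \<phi>0 by (auto simp: Hinf0_circle_def fc gc)
  have fb: "AE t in circ. cmod (f (cis t)) \<le> 3"
    using gw wr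
  proof eventually_elim
    case (elim t)
    have "(cmod (g (cis t)))\<^sup>2 \<le> 2\<^sup>2" using elim by simp
    then have "cmod (g (cis t)) \<le> 2" by (rule power2_le_imp_le) simp
    then show ?case
      using norm_triangle_ineq4[of "g (cis t)" "complex_of_real a"] a0 a1 by (simp add: f_def)
  qed
  have f3: "onorm (toeplitz f) \<le> 3"
    using norm_toeplitz_le[OF fL fb] by (intro onorm_bound) auto
  have split: "toeplitz g x = a *\<^sub>R x + toeplitz f x" for x
  proof (rule ell2_eqI)
    fix i
    have cL: "(\<lambda>z. complex_of_real a) \<in> Linf_circle" by (simp add: Linf_circle_iff)
    have cc: "fourier_coeff (\<lambda>z. complex_of_real a) n = (if n = 0 then complex_of_real a else 0)" for n
      unfolding fourier_coeff_eq fcoeff_const ..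
    have lc: "fourier_coeff g n = 1 * fourier_coeff (\<lambda>z. complex_of_real a) n + 1 * fourier_coeff f n" for n
      unfolding fc cc by simp
    show "coord (toeplitz g x) i = coord (a *\<^sub>R x + toeplitz f x) i"
      unfolding toeplitz_lin_comb[OF cL fL gL lc] toeplitz_const[OF cL cc] by simp
  qed
  show ?thesis
    using fH a0 a1 a2ge f3 Tg unfolding split by blast
qed

text \<open>The tolerance \<open>\<delta>^2 / 6\<close> times the norm bound 3 leaves an error
  \<open>\<delta>^2 / 2\<close> on a block, of the same order as the defect of \<open>a^2\<close>.
  Together they cost \<open>3 \<delta>^2\<close>, and division by \<open>\<delta>\<close> leaves
  \<open>3 \<delta>\<close>.\<close>

lemma paving_lower_bound:
  fixes u :: "complex \<Rightarrow> real"
  assumes ii: "\<And>f. f \<in> Hinf0_circle \<Longrightarrow> \<exists>A. paving r A \<and>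
      (\<forall>i\<in>{1..r}. onorm (diag_proj (A i) \<circ> toeplitz f \<circ> diag_proj (A i)) \<le> \<delta>\<^sup>2 / 6 * onorm (toeplitz f))"
    and u: "(\<lambda>z. complex_of_real (u z)) \<in> Linf_circle" "AE t in circ. \<bar>u (cis t)\<bar> \<le> 1"
      "(LINT t|circ. u (cis t)) = 0" and \<delta>: "0 < \<delta>" "\<delta> \<le> 1/2"
  shows "\<exists>A. paving r A \<and> (\<forall>i\<in>{1..r}. \<forall>x. diag_proj (A i) x = x \<longrightarrow>
      - 3 * \<delta> * (norm x)\<^sup>2 \<le> inner (toeplitz (\<lambda>z. complex_of_real (u z)) x) x)"
proof -
  let ?T = "toeplitz (\<lambda>z. complex_of_real (u z))"
  obtain f a where f: "f \<in> Hinf0_circle" "onorm (toeplitz f) \<le> 3"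
    and a: "0 < a" "a \<le> 1" "1 - 2 * \<delta>\<^sup>2 \<le> a\<^sup>2"
    and fac: "\<And>x. (norm (a *\<^sub>R x + toeplitz f x))\<^sup>2 \<le> (norm x)\<^sup>2 + \<delta> * inner (?T x) x"
    using toeplitz_analytic_factor[OF u \<delta>] by blast
  have fL: "f \<in> Linf_circle" using f by (simp add: Hinf0_circle_def)
  obtain A where A: "paving r A"
    "\<And>i. i \<in> {1..r} \<Longrightarrow> onorm (diag_proj (A i) \<circ> toeplitz f \<circ> diag_proj (A i)) \<le> \<delta>\<^sup>2 / 6 * onorm (toeplitz f)"
    using ii[OF f(1)] by blast
  have "\<delta>\<^sup>2 \<le> (1/2)\<^sup>2" using \<delta> by (intro power_mono) auto
  then have \<delta>2: "\<delta>\<^sup>2 \<le> 1/4" by (simp add: power2_eq_square)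
  have "a\<^sup>2 \<le> a" using a by (simp add: power2_eq_square mult_left_le)
  \<comment> \<open>Needed for squaring the lower bound: \<open>a \<ge> a^2 \<ge> 1/2\<close>, while
    \<open>\<delta>^2 / 2 \<le> 1/8\<close>.\<close>
  then have ad: "0 \<le> a - \<delta>\<^sup>2 / 2" using a \<delta>2 by linarith
  have "- 3 * \<delta> * (norm x)\<^sup>2 \<le> inner (?T x) x" if i: "i \<in> {1..r}" and x: "diag_proj (A i) x = x" for i x
  proof -
    have "norm (diag_proj (A i) (toeplitz f x)) \<le> onorm (diag_proj (A i) \<circ> toeplitz f \<circ> diag_proj (A i)) * norm x"
      by (rule norm_compression_le[OF bounded_linear_toeplitz[OF fL] x])
    also have "\<dots> \<le> (\<delta>\<^sup>2 / 6 * 3) * norm x"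
      using order_trans[OF A(2)[OF i] mult_left_mono[OF f(2), of "\<delta>\<^sup>2 / 6"]]
      by (intro mult_right_mono) auto
    finally have Pf: "norm (diag_proj (A i) (toeplitz f x)) \<le> \<delta>\<^sup>2 / 2 * norm x" by simp
    \<comment> \<open>The block projection fixes \<open>x\<close>, so applied to
      \<open>a x + T_f x\<close> it leaves \<open>a x\<close> alone and replaces
      \<open>T_f x\<close> by its small compression.\<close>
    have "a * norm x - \<delta>\<^sup>2 / 2 * norm x \<le> norm (a *\<^sub>R x) - norm (diag_proj (A i) (toeplitz f x))"
      using Pf a by simp
    also have "\<dots> \<le> norm (a *\<^sub>R x + diag_proj (A i) (toeplitz f x))"
      by (rule norm_diff_ineq)
    also have "a *\<^sub>R x + diag_proj (A i) (toeplitz f x) = diag_proj (A i) (a *\<^sub>R x + toeplitz f x)"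
      using bounded_linear.linear[OF bounded_linear_diag_proj, of "A i"] x
      by (simp add: linear_add linear_scale)
    also have "norm \<dots> \<le> norm (a *\<^sub>R x + toeplitz f x)" by (rule norm_diag_proj_le)
    finally have "(a - \<delta>\<^sup>2 / 2) * norm x \<le> norm (a *\<^sub>R x + toeplitz f x)"
      by (simp only: left_diff_distrib)
    then have "((a - \<delta>\<^sup>2 / 2) * norm x)\<^sup>2 \<le> (norm (a *\<^sub>R x + toeplitz f x))\<^sup>2"
      using ad by (intro power_mono mult_nonneg_nonneg norm_ge_zero)
    also have "\<dots> \<le> (norm x)\<^sup>2 + \<delta> * inner (?T x) x" by (rule fac)
    finally have 1: "(a - \<delta>\<^sup>2 / 2)\<^sup>2 * (norm x)\<^sup>2 \<le> (norm x)\<^sup>2 + \<delta> * inner (?T x) x"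
      by (simp add: power_mult_distrib)
    have "1 - 3 * \<delta>\<^sup>2 \<le> (a - \<delta>\<^sup>2 / 2)\<^sup>2"
    proof -
      have "(a - \<delta>\<^sup>2 / 2)\<^sup>2 = a\<^sup>2 - a * \<delta>\<^sup>2 + (\<delta>\<^sup>2 / 2)\<^sup>2" by (simp add: power2_diff)
      moreover have "a * \<delta>\<^sup>2 \<le> \<delta>\<^sup>2" using a by (simp add: mult_left_le_one_le)
      moreover have "0 \<le> (\<delta>\<^sup>2 / 2)\<^sup>2" by simp
      ultimately show ?thesis using a by linarith
    qed
    then have "(1 - 3 * \<delta>\<^sup>2) * (norm x)\<^sup>2 \<le> (a - \<delta>\<^sup>2 / 2)\<^sup>2 * (norm x)\<^sup>2"
      by (rule mult_right_mono) simp
    then have "\<delta> * (- 3 * \<delta> * (norm x)\<^sup>2) \<le> \<delta> * inner (?T x) x"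
      using 1 by (simp add: power2_eq_square left_diff_distrib mult.assoc)
    then show ?thesis using \<delta>(1) by (simp only: mult_le_cancel_left_pos)
  qed
  then show ?thesis using A(1) by blast
qed

text \<open>The form bound makes \<open>onorm T - u\<close> and \<open>onorm T + u\<close>
  nonnegative against every \<open>|q|^2\<close>, and the positivity test makes them nonnegative
  almost everywhere. This permits normalizing a symbol by its operator norm.\<close>

lemma symbol_le_onorm:
  fixes u :: "complex \<Rightarrow> real"
  assumes u: "(\<lambda>z. complex_of_real (u z)) \<in> Linf_circle"
  shows "AE t in circ. \<bar>u (cis t)\<bar> \<le> onorm (toeplitz (\<lambda>z. complex_of_real (u z)))"
proof -
  let ?T = "toeplitz (\<lambda>z. complex_of_real (u z))"
  have ub: "ess_bdd (\<lambda>t. u (cis t))"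
    using ess_bdd_Re[of "\<lambda>t. complex_of_real (u (cis t))"] u by (simp add: Linf_circle_iff)
  have "AE t in circ. 0 \<le> onorm ?T - s * u (cis t)" if s: "\<bar>s\<bar> = 1" for s
  proof (rule AE_nonneg_of_integral_poly)
    show "integrable circ (\<lambda>t. onorm ?T - s * u (cis t))"
      using ub by (auto intro!: ess_bdd_integrable)
    fix q
    let ?q = "ell2_of_poly q"
    have "(LINT t|circ. (onorm ?T - s * u (cis t)) * (cmod (poly q (cis t)))\<^sup>2)
        = (LINT t|circ. onorm ?T * (cmod (poly q (cis t)))\<^sup>2 - s * (u (cis t) * (cmod (poly q (cis t)))\<^sup>2))"
      by (simp add: algebra_simps)
    also have "\<dots> = onorm ?T * (LINT t|circ. (cmod (poly q (cis t)))\<^sup>2) - s * (LINT t|circ. u (cis t) * (cmod (poly q (cis t)))\<^sup>2)"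
      using ub by (subst Bochner_Integration.integral_diff) (auto intro!: ess_bdd_integrable)
    also have "\<dots> = 2 * pi * (onorm ?T * (norm ?q)\<^sup>2 - s * inner (?T ?q) ?q)"
      unfolding inner_toeplitz_poly[OF u] integral_cmod_poly_power2 by (simp add: algebra_simps)
    also have "0 \<le> \<dots>"
    proof -
      have "s * inner (?T ?q) ?q \<le> \<bar>s * inner (?T ?q) ?q\<bar>" by (rule abs_ge_self)
      also have "\<dots> \<le> onorm ?T * (norm ?q)\<^sup>2"
        unfolding abs_mult s using abs_inner_toeplitz_le[OF u] by simp
      finally show ?thesis by simp
    qed
    finally show "0 \<le> (LINT t|circ. (onorm ?T - s * u (cis t)) * (cmod (poly q (cis t)))\<^sup>2)" .
  qed
  from this[OF abs_one] this[OF abs_neg_one] show ?thesis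
    by eventually_elim (auto simp: abs_le_iff)
qed

text \<open>On a common refinement the lower bounds for \<open>u\<close> and \<open>-u\<close> bound
  the quadratic form from both sides; the compression is self-adjoint, so its norm obeys the same
  bound.\<close>

lemma self_adjoint_paving_of_analytic_paving:
  assumes ii: "\<And>f. f \<in> Hinf0_circle \<Longrightarrow> \<exists>A. paving r A \<and>
      (\<forall>i\<in>{1..r}. onorm (diag_proj (A i) \<circ> toeplitz f \<circ> diag_proj (A i)) \<le> \<delta>\<^sup>2 / 6 * onorm (toeplitz f))"
    and \<delta>: "0 < \<delta>" "\<delta> \<le> 1/2"
    and h: "h \<in> Linf_circle" "self_adjoint (toeplitz h)" "fourier_coeff h 0 = 0"
  shows "\<exists>A. paving (r * r) A \<and>
    (\<forall>i\<in>{1..r * r}. onorm (diag_proj (A i) \<circ> toeplitz h \<circ> diag_proj (A i)) \<le> 3 * \<delta> * onorm (toeplitz h))"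
proof -
  define M where "M = onorm (toeplitz h)"
  have M0: "0 \<le> M" unfolding M_def by (intro onorm_pos_le bounded_linear_toeplitz h)
  have hR: "(\<lambda>z. complex_of_real (Re (h z))) \<in> Linf_circle" by (rule Re_symbol(1)[OF h(1)])
  \<comment> \<open>\<open>h\<close> may be complex-valued on a null set of the circle; its
    pointwise real part is a genuinely real symbol with the same coefficients and hence the same
    operator.\<close>
  have hRc: "fourier_coeff (\<lambda>z. complex_of_real (Re (h z))) n = fourier_coeff h n" for n
    using h(2) unfolding Re_symbol(2)[OF h(1)] self_adjoint_toeplitz_iff[OF h(1)] by simp
  then have TR: "toeplitz (\<lambda>z. complex_of_real (Re (h z))) = toeplitz h"
    by (rule toeplitz_coeffs_eqI)
  have Reb: "ess_bdd (\<lambda>t. Re (h (cis t)))"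
    using h(1) by (auto simp: Linf_circle_iff)
  have Re0: "(LINT t|circ. Re (h (cis t))) = 0"
    using hRc[of 0] h(3) by (simp add: fourier_coeff_def)
  \<comment> \<open>If \<open>M = 0\<close>, division by zero makes \<open>u\<close> zero, which
    still satisfies the hypotheses on the normalized symbol. The identity \<open>uT\<close> is
    stated with the factor \<open>M\<close> to cover this case.\<close>
  define u where "u s z = s * Re (h z) / M" for s z
  have uL: "(\<lambda>z. complex_of_real (u s z)) \<in> Linf_circle" for s
    using ess_bdd_of_real[OF ess_bdd_mult[OF ess_bdd_const[of "s / M"] Reb]] by (simp add: Linf_circle_iff u_def)
  have u1: "AE t in circ. \<bar>u s (cis t)\<bar> \<le> 1" if "\<bar>s\<bar> = 1" for s
    using symbol_le_onorm[OF hR] unfolding TR M_def[symmetric]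
    by eventually_elim (use M0 that in \<open>auto simp: u_def abs_mult divide_le_eq_1\<close>)
  have u0: "(LINT t|circ. u s (cis t)) = 0" for s
    using Re0 by (simp add: u_def)
  have uT: "M * inner (toeplitz (\<lambda>z. complex_of_real (u s z)) x) x = s * inner (toeplitz h x) x" for s x
  proof (cases "M = 0")
    case True
    then have "norm (toeplitz h x) \<le> 0"
      using onorm[OF bounded_linear_toeplitz[OF h(1)], of x] by (simp add: M_def)
    then show ?thesis using True by simp
  next
    case False
    have lc: "fourier_coeff (\<lambda>z. complex_of_real (u s z)) n = complex_of_real (s / M) * fourier_coeff h n + 0 * fourier_coeff h n" for n
      unfolding hRc[symmetric, of n] unfolding fourier_coeff_eq fcoeff_cmult[symmetric] by (simp add: u_def fcoeff_const)
    have "toeplitz (\<lambda>z. complex_of_real (u s z)) x = (s / M) *\<^sub>R toeplitz h x"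
      by (rule ell2_eqI) (simp only: toeplitz_lin_comb[OF h(1) h(1) uL lc], simp)
    then show ?thesis using False by simp
  qed
  obtain A where A: "paving r A" "\<And>i x. i \<in> {1..r} \<Longrightarrow> diag_proj (A i) x = x \<Longrightarrow>
      - 3 * \<delta> * (norm x)\<^sup>2 \<le> inner (toeplitz (\<lambda>z. complex_of_real (u 1 z)) x) x"
    using paving_lower_bound[OF ii uL u1 u0 \<delta>, of 1] by auto
  obtain B where B: "paving r B" "\<And>i x. i \<in> {1..r} \<Longrightarrow> diag_proj (B i) x = x \<Longrightarrow>
      - 3 * \<delta> * (norm x)\<^sup>2 \<le> inner (toeplitz (\<lambda>z. complex_of_real (u (- 1) z)) x) x"
    using paving_lower_bound[OF ii uL u1 u0 \<delta>, of "- 1"] by auto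
  obtain C where C: "paving (r * r) C"
    "\<And>l. l \<in> {1..r * r} \<Longrightarrow> \<exists>i\<in>{1..r}. \<exists>j\<in>{1..r}. C l = A i \<inter> B j"
    using paving_common_refinement[OF A(1) B(1)] by blast
  have "onorm (diag_proj (C l) \<circ> toeplitz h \<circ> diag_proj (C l)) \<le> 3 * \<delta> * M" if l: "l \<in> {1..r * r}" for l
  proof -
    obtain i j where ij: "i \<in> {1..r}" "j \<in> {1..r}" "C l = A i \<inter> B j" using C(2)[OF l] by blast
    let ?P = "diag_proj (C l)"
    have quad: "\<bar>inner (toeplitz h x) x\<bar> \<le> 3 * \<delta> * M * (norm x)\<^sup>2" if x: "?P x = x" for x
    proof -
      have "A i \<inter> C l = C l" "B j \<inter> C l = C l" using ij(3) by auto
      then have "diag_proj (A i) x = x" "diag_proj (B j) x = x"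
        using x by (metis diag_proj_diag_proj)+
      then have "M * (- 3 * \<delta> * (norm x)\<^sup>2) \<le> 1 * inner (toeplitz h x) x"
        "M * (- 3 * \<delta> * (norm x)\<^sup>2) \<le> - 1 * inner (toeplitz h x) x"
        unfolding uT[symmetric] using A(2)[OF ij(1), of x] B(2)[OF ij(2), of x] M0
        by (blast intro: mult_left_mono)+
      then show ?thesis by (simp add: abs_le_iff mult_ac)
    qed
    let ?S = "?P \<circ> toeplitz h \<circ> ?P"
    have "norm (?S x) \<le> 3 * \<delta> * M * norm x" for x
    proof (rule norm_le_of_quadratic_form)
      show "linear ?S"
        by (intro linear_compose bounded_linear.linear bounded_linear_diag_proj bounded_linear_toeplitz h)
      show "inner (?S x) y = inner x (?S y)" for x y
        by (simp add: inner_diag_proj inner_self_adjoint[OF h(2)])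
      fix x
      have "\<bar>inner (?S x) x\<bar> = \<bar>inner (toeplitz h (?P x)) (?P x)\<bar>"
        by (simp add: inner_diag_proj)
      also have "\<dots> \<le> 3 * \<delta> * M * (norm (?P x))\<^sup>2"
        by (rule quad) (simp add: diag_proj_diag_proj)
      also have "\<dots> \<le> 3 * \<delta> * M * (norm x)\<^sup>2"
        using \<delta> M0 by (intro mult_left_mono power_mono norm_diag_proj_le) auto
      finally show "\<bar>inner (?S x) x\<bar> \<le> 3 * \<delta> * M * (norm x)\<^sup>2" .
    qed
    then show ?thesis using \<delta> M0 by (intro onorm_bound) auto
  qed
  then show ?thesis using C(1) unfolding M_def by blast
qed

section \<open>The equivalence, with the constants of both directions\<close>

theorem theorem2p14:
  "(\<forall>\<epsilon>>0::real. \<exists>r1::nat. \<forall>h\<in>Linf_circle.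
       self_adjoint (toeplitz h) \<and> fourier_coeff h 0 = 0 \<longrightarrow>
       (\<exists>A. paving r1 A \<and>
          (\<forall>i\<in>{1..r1}. onorm (diag_proj (A i) \<circ> toeplitz h \<circ> diag_proj (A i))
                        \<le> \<epsilon> * onorm (toeplitz h))))
   \<longleftrightarrow>
   (\<forall>\<epsilon>>0::real. \<exists>r2::nat. \<forall>f\<in>Hinf0_circle.
       (\<exists>A. paving r2 A \<and>
          (\<forall>i\<in>{1..r2}. onorm (diag_proj (A i) \<circ> toeplitz f \<circ> diag_proj (A i))
                        \<le> \<epsilon> * onorm (toeplitz f))))"
  (is "?i \<longleftrightarrow> ?ii")
proof
  assume i: ?i
  show ?ii
  proof (intro allI impI)
    fix \<epsilon> :: real assume \<epsilon>: "0 < \<epsilon>"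
    \<comment> \<open>Half of the tolerance for each of the two parts of the symbol.\<close>
    then have \<epsilon>2: "0 < \<epsilon> / 2" by simp
    then obtain r where r: "\<And>h. h \<in> Linf_circle \<Longrightarrow> self_adjoint (toeplitz h) \<Longrightarrow> fourier_coeff h 0 = 0 \<Longrightarrow>
        \<exists>A. paving r A \<and> (\<forall>i\<in>{1..r}. onorm (diag_proj (A i) \<circ> toeplitz h \<circ> diag_proj (A i)) \<le> \<epsilon> / 2 * onorm (toeplitz h))"
      using i by blast
    have "\<forall>f\<in>Hinf0_circle. \<exists>A. paving (r * r) A \<and>
        (\<forall>i\<in>{1..r * r}. onorm (diag_proj (A i) \<circ> toeplitz f \<circ> diag_proj (A i)) \<le> \<epsilon> * onorm (toeplitz f))"
    proof
      fix f assume "f \<in> Hinf0_circle"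
      have eq: "2 * (\<epsilon> / 2) = \<epsilon>" by simp
      from analytic_paving_of_self_adjoint_paving[OF r \<epsilon>2 \<open>f \<in> Hinf0_circle\<close>]
      show "\<exists>A. paving (r * r) A \<and>
          (\<forall>i\<in>{1..r * r}. onorm (diag_proj (A i) \<circ> toeplitz f \<circ> diag_proj (A i)) \<le> \<epsilon> * onorm (toeplitz f))"
        unfolding eq .
    qed
    then show "\<exists>r2. \<forall>f\<in>Hinf0_circle. \<exists>A. paving r2 A \<and>
        (\<forall>i\<in>{1..r2}. onorm (diag_proj (A i) \<circ> toeplitz f \<circ> diag_proj (A i)) \<le> \<epsilon> * onorm (toeplitz f))"
      by blast
  qed
next
  assume ii: ?ii
  show ?i
  proof (intro allI impI)
    fix \<epsilon> :: real assume \<epsilon>: "0 < \<epsilon>"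
    \<comment> \<open>The cap 1/2 keeps the weight \<open>1 + \<delta> u\<close> between 1/2 and
      3/2; the value \<open>\<epsilon> / 3\<close> absorbs the factor in
      \<open>3 * \<delta>\<close>.\<close>
    define \<delta> where "\<delta> = min (1/2) (\<epsilon> / 3)"
    have \<delta>: "0 < \<delta>" "\<delta> \<le> 1/2" "3 * \<delta> \<le> \<epsilon>" using \<epsilon> by (auto simp: \<delta>_def)
    then have "0 < \<delta>\<^sup>2 / 6" by simp
    then obtain r where r: "\<And>f. f \<in> Hinf0_circle \<Longrightarrow> \<exists>A. paving r A \<and>
        (\<forall>i\<in>{1..r}. onorm (diag_proj (A i) \<circ> toeplitz f \<circ> diag_proj (A i)) \<le> \<delta>\<^sup>2 / 6 * onorm (toeplitz f))"
      using ii by blast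
    have "\<exists>A. paving (r * r) A \<and>
        (\<forall>i\<in>{1..r * r}. onorm (diag_proj (A i) \<circ> toeplitz h \<circ> diag_proj (A i)) \<le> \<epsilon> * onorm (toeplitz h))"
      if h: "h \<in> Linf_circle" "self_adjoint (toeplitz h)" "fourier_coeff h 0 = 0" for h
    proof -
      have "3 * \<delta> * onorm (toeplitz h) \<le> \<epsilon> * onorm (toeplitz h)"
        using \<delta> by (intro mult_right_mono onorm_pos_le bounded_linear_toeplitz h)
      then show ?thesis
        using self_adjoint_paving_of_analytic_paving[OF r \<delta>(1,2) h] by (meson order_trans)
    qed
    then show "\<exists>r1. \<forall>h\<in>Linf_circle. self_adjoint (toeplitz h) \<and> fourier_coeff h 0 = 0 \<longrightarrow>
       (\<exists>A. paving r1 A \<and> (\<forall>i\<in>{1..r1}. onorm (diag_proj (A i) \<circ> toeplitz h \<circ> diag_proj (A i))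
          \<le> \<epsilon> * onorm (toeplitz h)))"
      by blast
  qed
qed

end
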